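(* Let $n\ge 1$ and for $k=1,\dots,n$ let $L_k\in\mathbb{R}^{N\times N}$ be the weighted graph Laplacian of a graph that contains a connected spanning tree, with $L_k=L_k^T$. Let $U_{\mathrm{ref}}\in\mathcal{R}\mathcal{H}_\infty$ and $\Delta_0,\Delta_1,\dots,\Delta_n\in\mathcal{R}\mathcal{H}_\infty$. Then the perturbed $n$th order serial consensus system $$\left(sI+s\Delta_0+(I+\Delta_n)L_n\right)\prod_{k=1}^{n-1}\left(sI+(I+\Delta_k)L_k\right)X=U_{\mathrm{ref}}$$ achieves $n$th order consensus if $$\|\Delta_k\|_{\mathcal{H}_\infty}<1\quad\text{for all }k$$ and $$\|\Delta_0\|_{\mathcal{H}_\infty}+\|\Delta_n\|_{\mathcal{H}_\infty}<1.$$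
   Context: A weighted graph on the vertex set $\mathcal{V}=\{1,\dots,N\}$ with edge set $\mathcal{E}$ is described by a nonnegative adjacency matrix $W$ with $w_{i,j}>0$ if and only if $(j,i)\in\mathcal{E}$; its graph Laplacian $L$ has entries $[L]_{i,j}=-w_{i,j}$ for $i\neq j$ and $[L]_{i,i}=\sum_{k\ne i}w_{i,k}$. The graph contains a connected spanning tree if there is a vertex $i$ from which there is a (directed) path to every other vertex $j$. $\mathcal{R}\mathcal{H}_\infty$ denotes the space of proper, real rational, stable transfer matrices, with norm $\|\cdot\|_{\mathcal{H}_\infty}$; here $U_{\mathrm{ref}}$ is an $N$-vector and each $\Delta_k$ is an $N\times N$ transfer matrix. $X=X(s)$ is the Laplace transform of $x(t)=(x_1(t),\dots,x_N(t))^T$. Matrix products are ordered, with the factor $k=1$ leftmost. The system achieves $n$th order consensus if $\lim_{t\to\infty}|x_i^{(k)}(t)-x_j^{(k)}(t)|=0$ for all $i,j\in\mathcal{V}$ and all $k\in\{0,1,\dots,n-1\}$, where $x_i^{(k)}$ is the $k$th time derivative of $x_i$. *)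

theory Defs
  imports "HOL-Analysis.Analysis" "HOL-Computational_Algebra.Polynomial"
begin

text \<open>An edge \<open>(j, i)\<close> points from \<open>j\<close> to \<open>i\<close> and carries the weight \<open>W $ i $ j\<close>.\<close>

definition adjacency_matrix :: "('N::finite \<times> 'N) set \<Rightarrow> real^'N^'N \<Rightarrow> bool" where
  "adjacency_matrix E W \<longleftrightarrow>
     (\<forall>i j. 0 \<le> W $ i $ j) \<and> (\<forall>i j. 0 < W $ i $ j \<longleftrightarrow> (j, i) \<in> E)"

definition graph_laplacian :: "real^'N^'N \<Rightarrow> real^'N^'N::finite" where
  "graph_laplacian W =
     (\<chi> i j. if i = j then (\<Sum>k\<in>UNIV - {i}. W $ i $ k) else - W $ i $ j)"

definition connected_spanning_tree :: "('N \<times> 'N) set \<Rightarrow> bool" where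
  "connected_spanning_tree E \<longleftrightarrow> (\<exists>i. \<forall>j. j \<noteq> i \<longrightarrow> (i, j) \<in> E\<^sup>+)"

text \<open>A transfer function is represented as a function on the complex plane; at the zeros of the
  denominator, which all lie in the open left half plane, its value is unconstrained.\<close>

definition RHinf :: "(complex \<Rightarrow> complex) set" where
  "RHinf = {g. \<exists>p q :: real poly.
      degree p \<le> degree q \<and>
      (\<forall>s. 0 \<le> Re s \<longrightarrow> poly (map_poly complex_of_real q) s \<noteq> 0) \<and>
      (\<forall>s. poly (map_poly complex_of_real q) s \<noteq> 0 \<longrightarrow>
         g s = poly (map_poly complex_of_real p) s / poly (map_poly complex_of_real q) s)}"

definition RHinf_vec :: "(complex \<Rightarrow> complex^'N) set" where
  "RHinf_vec = {G. \<forall>i. (\<lambda>s. G s $ i) \<in> RHinf}"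

definition RHinf_mat :: "(complex \<Rightarrow> complex^'N^'M) set" where
  "RHinf_mat = {G. \<forall>i j. (\<lambda>s. G s $ i $ j) \<in> RHinf}"

text \<open>Since \<open>complex^'N\<close> carries the Euclidean norm, \<open>onorm\<close> is the largest singular value. The
  supremum is over a set that is bounded above whenever \<open>G\<close> is in \<open>RHinf_mat\<close>.\<close>

definition hinf_norm :: "(complex \<Rightarrow> complex^'N^'M) \<Rightarrow> real" where
  "hinf_norm G = (SUP s\<in>{s. 0 < Re s}. onorm (\<lambda>v. G s *v v))"

text \<open>Ordered product \<open>A k\<^sub>1 ** (A k\<^sub>2 ** \<dots>)\<close> along a list of indices; empty product \<open>mat 1\<close>.\<close>

definition ordered_prod :: "('k \<Rightarrow> complex^'N^'N) \<Rightarrow> 'k list \<Rightarrow> complex^'N^'N" where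
  "ordered_prod A ks = foldr (\<lambda>k M. A k ** M) ks (mat 1)"

text \<open>\<open>mat s\<close> is \<open>s I\<close>, and \<open>[1..<n]\<close> lists \<open>1, \<dots>, n - 1\<close>.\<close>

definition perturbed_serial_consensus ::
  "nat \<Rightarrow> (nat \<Rightarrow> real^'N^'N) \<Rightarrow> (nat \<Rightarrow> complex \<Rightarrow> complex^'N^'N) \<Rightarrow> complex \<Rightarrow> complex^'N^'N::finite" where
  "perturbed_serial_consensus n L \<Delta> s =
     (mat s + mat s ** \<Delta> 0 s + (mat 1 + \<Delta> n s) ** map_matrix complex_of_real (L n)) **
     ordered_prod (\<lambda>k. mat s + (mat 1 + \<Delta> k s) ** map_matrix complex_of_real (L k)) [1..<n]"

text \<open>\<open>X\<close> is the Laplace transform of \<open>x\<close> on the half plane to the right of \<open>c\<close>. The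
  Henstock--Kurzweil integral over \<open>{0..}\<close> covers conditionally convergent improper integrals.\<close>

definition laplace_transform_right_of ::
  "real \<Rightarrow> (real \<Rightarrow> real^'N) \<Rightarrow> (complex \<Rightarrow> complex^'N) \<Rightarrow> bool" where
  "laplace_transform_right_of c x X \<longleftrightarrow>
     (\<forall>s i. c < Re s \<longrightarrow>
        ((\<lambda>t. exp (- s * complex_of_real t) * complex_of_real (x t $ i)) has_integral X s $ i) {0..})"

text \<open>The first conjunct says that the derivatives up to order \<open>n - 1\<close> exist on \<open>t > 0\<close>, so that
  the iterates of \<open>deriv\<close> in the second one are meaningful.\<close>

definition achieves_consensus :: "nat \<Rightarrow> (real \<Rightarrow> real^'N) \<Rightarrow> bool" where
  "achieves_consensus n x \<longleftrightarrow>
     (\<forall>i k. Suc k < n \<longrightarrow> (\<forall>t>0. (deriv ^^ k) (\<lambda>t. x t $ i) differentiable (at t))) \<and>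
     (\<forall>i j. \<forall>k<n.
        ((\<lambda>t. \<bar>(deriv ^^ k) (\<lambda>t. x t $ i) t - (deriv ^^ k) (\<lambda>t. x t $ j) t\<bar>) \<longlongrightarrow> 0) at_top)"

end

theory Submission
  imports Defs "HOL-Computational_Algebra.Fundamental_Theorem_Algebra"
begin

text \<open>Each factor of the system has the form \<open>s G + H K\<close>, where \<open>K\<close> is a symmetric Laplacian,
  \<open>H = I + \<Delta>\<^sub>k\<close>, and \<open>G\<close> is \<open>I\<close> or, for the leading factor, \<open>I + \<Delta>\<^sub>0\<close>. It is singular
  at \<open>s = 0\<close>, but only in the direction of consensus. To isolate this direction, fix a vertex
  \<open>r\<close> and write \<open>y = y\<^sub>r 1 + z\<close> with \<open>z\<^sub>r = 0\<close>. Since \<open>K 1 = 0\<close>,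
  \<open>(s G + H K) y = G (s y\<^sub>r 1 + s z) + H K z\<close>, which is linear in the pair of \<open>\<beta> = s y\<^sub>r\<close> and
  \<open>z\<close>. The resulting square system (\<open>split_pencil\<close>) is nonsingular on the whole closed right half
  plane (\<open>split_pencil_nonsingular\<close>): for \<open>p = \<beta> 1 + s z\<close> and \<open>q = K z\<close> the Laplacian form
  gives \<open>p \<bullet> q = Re s * (z \<bullet> K z) \<ge> 0\<close>, so \<open>p + q\<close> is at least as long as \<open>p\<close> and
  \<open>q\<close>, while \<open>G p + H q = 0\<close> would make its norm at most
  \<open>\<parallel>\<Delta>\<^sub>0\<parallel> \<parallel>p\<parallel> + \<parallel>\<Delta>\<^sub>k\<parallel> \<parallel>q\<parallel>\<close>. As the gains add up to less than one,
  \<open>p = q = 0\<close>, and the spanning tree turns this into \<open>z = 0\<close> and \<open>\<beta> = 0\<close>.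

  By Cramer's rule (\<open>serial_factor_step\<close>) the disagreement \<open>z\<close> is rational without poles in the
  closed right half plane, whenever the right-hand side is so up to a multiple of \<open>G 1\<close>, which only
  shifts \<open>\<beta>\<close>. The leading factor receives the stable input, and for the others \<open>G 1 = 1\<close>, so this
  property passes through the ordered product (\<open>disagreement_through_product\<close>). Poles at zero
  accumulate in the common component \<open>X\<^sub>r\<close> only: each \<open>X\<^sub>i\<close> is rational, and each
  \<open>X\<^sub>i - X\<^sub>j\<close> is rational and stable.

  It remains to return to the time domain, where \<open>x\<close> is known through convergence of its Laplace
  integrals alone. By partial fractions there is an exponential polynomial whose transform differs
  from the given one by a polynomial (\<open>strictly_proper_inverse_laplace\<close>), and a uniqueness theorem
  for conditionally convergent transforms identifies it with the signal at all positive times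
  (\<open>lerch_constant\<close>, \<open>rational_laplace_imp_exp_poly\<close>). Its exponents are zeros of the denominator.
  Hence every \<open>x\<^sub>i\<close> is smooth for positive times, and all derivatives of \<open>x\<^sub>i - x\<^sub>j\<close> are
  exponential polynomials with exponents in the open left half plane, which decay.\<close>

section \<open>The Laplacian quadratic form\<close>

text \<open>The diagonal entry is the sum of the weights off the diagonal in its row, which pairs each
  neighbour's component with the own one.\<close>

lemma laplacian_mult_component:
  fixes W :: "real^'N::finite^'N" and z :: "complex^'N"
  shows "(map_matrix complex_of_real (graph_laplacian W) *v z) $ i
       = (\<Sum>j\<in>UNIV. of_real (W $ i $ j) * (z $ i - z $ j))"
proof -
  have "(map_matrix complex_of_real (graph_laplacian W) *v z) $ i
      = (\<Sum>k\<in>UNIV - {i}. of_real (W $ i $ k)) * z $ i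
        + (\<Sum>j\<in>UNIV - {i}. - of_real (W $ i $ j) * z $ j)"
    unfolding matrix_vector_mult_def graph_laplacian_def map_matrix_def
    by (simp add: sum.remove[of UNIV i])
  also have "\<dots> = (\<Sum>j\<in>UNIV - {i}. of_real (W $ i $ j) * (z $ i - z $ j))"
    by (simp add: right_diff_distrib sum_subtractf sum_negf sum_distrib_right)
  also have "\<dots> = (\<Sum>j\<in>UNIV. of_real (W $ i $ j) * (z $ i - z $ j))"
    by (simp add: sum.remove[of UNIV i])
  finally show ?thesis .
qed

lemma weights_symmetric:
  assumes "graph_laplacian W = transpose (graph_laplacian W)" "i \<noteq> j"
  shows "W $ i $ j = W $ j $ i"
proof -
  have "graph_laplacian W $ i $ j = graph_laplacian W $ j $ i"
    by (subst assms(1)) (simp add: transpose_def)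
  with assms(2) show ?thesis by (simp add: graph_laplacian_def)
qed

text \<open>Summation by parts over the edges. The first argument is kept independent of the second because
  the form is needed for a pair \<open>p\<close>, \<open>z\<close> whose component differences are proportional but
  which are not proportional themselves.\<close>

lemma inner_laplacian:
  fixes p z :: "complex^'N::finite"
  assumes "graph_laplacian W = transpose (graph_laplacian W)"
  shows "2 * (p \<bullet> (map_matrix complex_of_real (graph_laplacian W) *v z))
       = (\<Sum>i\<in>UNIV. \<Sum>j\<in>UNIV. W $ i $ j * ((p $ i - p $ j) \<bullet> (z $ i - z $ j)))"
proof -
  let ?f = "\<lambda>i j. W $ i $ j * (p $ i \<bullet> (z $ i - z $ j))"
  have eq: "p \<bullet> (map_matrix complex_of_real (graph_laplacian W) *v z) = (\<Sum>i\<in>UNIV. \<Sum>j\<in>UNIV. ?f i j)"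
    unfolding inner_vec_def laplacian_mult_component inner_sum_right
    by (simp add: scaleR_conv_of_real[symmetric])
  have "?f j i = - (W $ i $ j * (p $ j \<bullet> (z $ i - z $ j)))" for i j
    using weights_symmetric[OF assms, of i j] by (cases "i = j") (auto simp: inner_diff_right algebra_simps)
  then have "(\<Sum>i\<in>UNIV. \<Sum>j\<in>UNIV. ?f i j) = (\<Sum>i\<in>UNIV. \<Sum>j\<in>UNIV. - (W $ i $ j * (p $ j \<bullet> (z $ i - z $ j))))"
    by (subst sum.swap) simp
  then have "2 * (p \<bullet> (map_matrix complex_of_real (graph_laplacian W) *v z))
      = (\<Sum>i\<in>UNIV. \<Sum>j\<in>UNIV. ?f i j) + (\<Sum>i\<in>UNIV. \<Sum>j\<in>UNIV. - (W $ i $ j * (p $ j \<bullet> (z $ i - z $ j))))"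
    using eq by simp
  also have "\<dots> = (\<Sum>i\<in>UNIV. \<Sum>j\<in>UNIV. W $ i $ j * ((p $ i - p $ j) \<bullet> (z $ i - z $ j)))"
    unfolding sum.distrib[symmetric]
    by (intro sum.cong refl) (simp add: inner_diff_left algebra_simps)
  finally show ?thesis .
qed

lemma complex_scaled_inner_self: "(s * d) \<bullet> d = Re s * (norm d)\<^sup>2" for s d :: complex
  by (simp add: inner_complex_def cmod_power2) (simp add: algebra_simps power2_eq_square)

text \<open>On the kernel the quadratic form is a vanishing sum of nonnegative edge terms, so \<open>z\<close> agrees at
  the two ends of every edge, hence along every path that starts at the root of the tree.\<close>

lemma laplacian_kernel_constant:
  fixes z :: "complex^'N::finite"
  assumes "adjacency_matrix E W" "connected_spanning_tree E"
    and sym: "graph_laplacian W = transpose (graph_laplacian W)"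
    and ker: "map_matrix complex_of_real (graph_laplacian W) *v z = 0"
  shows "z $ i = z $ j"
proof -
  have nonneg: "0 \<le> W $ i $ j" for i j
    using assms(1) by (auto simp: adjacency_matrix_def)
  have "(\<Sum>i\<in>UNIV. \<Sum>j\<in>UNIV. W $ i $ j * ((z $ i - z $ j) \<bullet> (z $ i - z $ j))) = 0"
    using inner_laplacian[OF sym, of z z] ker by simp
  then have zero: "W $ i $ j * ((z $ i - z $ j) \<bullet> (z $ i - z $ j)) = 0" for i j
    by (simp add: sum_nonneg_eq_0_iff sum_nonneg nonneg)
  have edge: "z $ a = z $ b" if "(a, b) \<in> E" for a b
  proof -
    have "W $ b $ a > 0" using that assms(1) by (auto simp: adjacency_matrix_def)
    with zero[of b a] show ?thesis by simp
  qed
  have path: "z $ a = z $ b" if "(a, b) \<in> E\<^sup>+" for a b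
    using that by (induction rule: trancl_induct) (auto dest: edge)
  obtain a where "\<And>j. j \<noteq> a \<Longrightarrow> (a, j) \<in> E\<^sup>+"
    using assms(2) by (auto simp: connected_spanning_tree_def)
  then have "z $ j = z $ a" for j
    using path[of a j] by (cases "j = a") auto
  then show ?thesis by metis
qed

section \<open>Splitting off the consensus direction\<close>

text \<open>Write \<open>y\<close> as \<open>y\<^sub>r\<close> times the all-ones vector plus \<open>z\<close>, where \<open>z\<close> vanishes
  at \<open>r\<close>. If \<open>K\<close> annihilates the all-ones vector, then \<open>s G y + H K y\<close> depends on \<open>s y\<^sub>r\<close>
  and \<open>z\<close> only. The pencil below is the matrix of this map, with the unknown \<open>s y\<^sub>r\<close> stored in
  the component \<open>r\<close> that \<open>z\<close> leaves free. Absorbing the factor \<open>s\<close> into the unknown removes the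
  singularity that \<open>s G + H K\<close> has at \<open>s = 0\<close>.\<close>

definition split_pencil ::
  "'N \<Rightarrow> complex^'N^'N \<Rightarrow> complex^'N^'N \<Rightarrow> complex^'N^'N \<Rightarrow> complex \<Rightarrow> complex^'N^'N::finite" where
  "split_pencil r G H K s =
     G ** (\<chi> i j. if j = r then 1 else if i = j then s else 0) +
     H ** (\<chi> i j. if j = r then 0 else K $ i $ j)"

lemma split_pencil_mult:
  fixes w :: "complex^'N::finite" and r :: 'N
  defines "z \<equiv> \<chi> i. if i = r then 0 else w $ i"
  shows "split_pencil r G H K s *v w = G *v (\<chi> i. w $ r + s * z $ i) + H *v (K *v z)"
proof -
  have "(\<chi> i j. if j = r then 1 else if i = j then s else 0) *v w = (\<chi> i. w $ r + s * z $ i)"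
    by (auto simp: vec_eq_iff matrix_vector_mult_def z_def sum.remove[of UNIV r] if_distrib[of "\<lambda>x. x * _"] sum.delta
        intro!: sum.neutral cong: if_cong)
  moreover have "(\<chi> i j. if j = r then 0 else K $ i $ j) *v w = K *v z"
    by (auto simp: vec_eq_iff matrix_vector_mult_def z_def intro!: sum.cong)
  ultimately show ?thesis
    unfolding split_pencil_def
    by (simp only: matrix_vector_mult_add_rdistrib matrix_vector_mul_assoc[symmetric])
qed

text \<open>For vectors at an angle of at most ninety degrees, \<open>norm (p + q)\<close> dominates both
  \<open>norm p\<close> and \<open>norm q\<close>, whereas perturbations of total gain below one cannot compensate a vector
  that long. This is where the condition on the sum of the two norms enters.\<close>

lemma small_perturbation_trivial:
  fixes p q :: "'a::real_inner"
  assumes "p + P + (q + Q) = 0" "0 \<le> p \<bullet> q"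
    and "norm P \<le> a * norm p" "norm Q \<le> b * norm q" "0 \<le> a" "0 \<le> b" "a + b < 1"
  shows "p = 0 \<and> q = 0"
proof -
  have eq: "p + q = - (P + Q)" using assms(1) by (simp add: algebra_simps eq_neg_iff_add_eq_0)
  define m where "m = max (norm p) (norm q)"
  have sq: "(norm (p + q))\<^sup>2 = (norm p)\<^sup>2 + (norm q)\<^sup>2 + 2 * (p \<bullet> q)"
    by (simp add: power2_norm_eq_inner inner_add_left inner_add_right inner_commute)
  have "(norm p)\<^sup>2 \<le> (norm (p + q))\<^sup>2" "(norm q)\<^sup>2 \<le> (norm (p + q))\<^sup>2"
    unfolding sq using assms(2) by simp_all
  then have "m \<le> norm (p + q)" unfolding m_def by (simp add: power2_le_iff_abs_le)
  also have "\<dots> \<le> norm P + norm Q" unfolding eq by (metis norm_minus_cancel norm_triangle_ineq)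
  also have "\<dots> \<le> a * norm p + b * norm q" using assms by linarith
  also have "\<dots> \<le> a * m + b * m"
    using assms(5,6) by (intro add_mono mult_left_mono) (auto simp: m_def)
  finally have "(1 - (a + b)) * m \<le> 0" by (simp add: algebra_simps)
  with assms(7) have "m \<le> 0" by (simp add: mult_le_0_iff)
  then show ?thesis
    by (metis m_def max.bounded_iff norm_le_zero_iff)
qed

text \<open>For \<open>w\<close> in the kernel put \<open>p = w\<^sub>r 1 + s z\<close> and \<open>q = K z\<close>. The component differences
  of \<open>p\<close> are \<open>s\<close> times those of \<open>z\<close>, so the quadratic form gives
  \<open>p \<bullet> q = Re s * (z \<bullet> K z) \<ge> 0\<close> and both vectors vanish. Then \<open>z\<close> is constant and zero at
  \<open>r\<close>, and finally \<open>w\<^sub>r = 0\<close>.\<close>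

lemma split_pencil_nonsingular:
  fixes W :: "real^'N::finite^'N"
  assumes graph: "adjacency_matrix E W" "connected_spanning_tree E"
    and sym: "graph_laplacian W = transpose (graph_laplacian W)"
    and s: "0 \<le> Re s"
    and bounds: "\<And>v. norm (A *v v) \<le> a * norm v" "\<And>v. norm (B *v v) \<le> b * norm v"
      "0 \<le> a" "0 \<le> b" "a + b < 1"
  shows "det (split_pencil r (mat 1 + A) (mat 1 + B)
           (map_matrix complex_of_real (graph_laplacian W)) s) \<noteq> 0" (is "det ?M \<noteq> 0")
proof -
  let ?K = "map_matrix complex_of_real (graph_laplacian W)"
  have "w = 0" if w: "?M *v w = 0" for w
  proof -
    define z where "z = (\<chi> i. if i = r then 0 else w $ i)"
    define p where "p = (\<chi> i. w $ r + s * z $ i)"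
    have "p + A *v p + (?K *v z + B *v (?K *v z)) = 0"
      using w unfolding split_pencil_mult z_def[symmetric] p_def[symmetric]
      by (simp add: matrix_vector_mult_add_rdistrib)
    moreover have "0 \<le> p \<bullet> (?K *v z)"
    proof -
      have "p $ i - p $ j = s * (z $ i - z $ j)" for i j
        by (simp add: p_def algebra_simps)
      then have "2 * (p \<bullet> (?K *v z)) = (\<Sum>i\<in>UNIV. \<Sum>j\<in>UNIV. W $ i $ j * (Re s * (norm (z $ i - z $ j))\<^sup>2))"
        by (simp add: inner_laplacian[OF sym] complex_scaled_inner_self)
      also have "\<dots> \<ge> 0"
        using graph(1) s by (intro sum_nonneg) (auto simp: adjacency_matrix_def)
      finally show ?thesis by simp
    qed
    ultimately have pq: "p = 0 \<and> ?K *v z = 0"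
      using bounds by (rule small_perturbation_trivial[where a = a and b = b])
    have "z $ i = z $ r" for i
      using laplacian_kernel_constant[OF graph sym] pq by blast
    then have z0: "z $ i = 0" for i by (simp add: z_def)
    have "w $ r = p $ r" by (simp add: p_def z0)
    then have "w $ r = 0" using pq by simp
    moreover have "w $ i = 0" if "i \<noteq> r" for i
      using z0[of i] that by (simp add: z_def)
    ultimately show "w = 0" by (metis vec_eq_iff zero_index)
  qed
  then have "invertible ?M"
    by (simp add: invertible_left_inverse matrix_left_invertible_ker)
  then show ?thesis by (simp add: invertible_det_nz)
qed

section \<open>Rational functions without poles on a set\<close>

text \<open>Two sets are used for \<open>Z\<close> later: the closed right half plane, where the predicate expresses
  stability, and an open half plane further to the right, where it expresses mere rationality.\<close>

definition rat_on :: "complex set \<Rightarrow> (complex \<Rightarrow> complex) \<Rightarrow> bool" where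
  "rat_on Z g \<longleftrightarrow> (\<exists>p q. \<forall>s\<in>Z. poly q s \<noteq> 0 \<and> g s = poly p s / poly q s)"

lemma rat_on_subset: "rat_on Z g \<Longrightarrow> D \<subseteq> Z \<Longrightarrow> rat_on D g"
  unfolding rat_on_def by blast

lemma rat_on_cong: "(\<And>s. s \<in> Z \<Longrightarrow> f s = g s) \<Longrightarrow> rat_on Z f \<longleftrightarrow> rat_on Z g"
  unfolding rat_on_def by auto

lemma rat_on_const: "rat_on Z (\<lambda>s. c)"
  unfolding rat_on_def by (intro exI[of _ "[:c:]"] exI[of _ 1]) simp

lemma rat_on_ident: "rat_on Z (\<lambda>s. s)"
  unfolding rat_on_def by (intro exI[of _ "[:0, 1:]"] exI[of _ 1]) simp

lemma rat_on_add:
  assumes "rat_on Z f" "rat_on Z g" shows "rat_on Z (\<lambda>s. f s + g s)"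
proof -
  obtain p q p' q' where "\<forall>s\<in>Z. poly q s \<noteq> 0 \<and> f s = poly p s / poly q s"
    "\<forall>s\<in>Z. poly q' s \<noteq> 0 \<and> g s = poly p' s / poly q' s"
    using assms unfolding rat_on_def by blast
  then show ?thesis unfolding rat_on_def
    by (intro exI[of _ "p * q' + p' * q"] exI[of _ "q * q'"]) (auto simp: field_simps)
qed

lemma rat_on_mult:
  assumes "rat_on Z f" "rat_on Z g" shows "rat_on Z (\<lambda>s. f s * g s)"
proof -
  obtain p q p' q' where "\<forall>s\<in>Z. poly q s \<noteq> 0 \<and> f s = poly p s / poly q s"
    "\<forall>s\<in>Z. poly q' s \<noteq> 0 \<and> g s = poly p' s / poly q' s"
    using assms unfolding rat_on_def by blast
  then show ?thesis unfolding rat_on_def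
    by (intro exI[of _ "p * p'"] exI[of _ "q * q'"]) (auto simp: field_simps)
qed

lemma rat_on_divide:
  assumes "rat_on Z f" "rat_on Z g" "\<And>s. s \<in> Z \<Longrightarrow> g s \<noteq> 0" shows "rat_on Z (\<lambda>s. f s / g s)"
proof -
  obtain p q p' q' where f: "\<forall>s\<in>Z. poly q s \<noteq> 0 \<and> f s = poly p s / poly q s"
    and g: "\<forall>s\<in>Z. poly q' s \<noteq> 0 \<and> g s = poly p' s / poly q' s"
    using assms unfolding rat_on_def by blast
  have "poly p' s \<noteq> 0" if "s \<in> Z" for s
    using g that assms(3)[OF that] by auto
  with f g show ?thesis unfolding rat_on_def
    by (intro exI[of _ "p * q'"] exI[of _ "q * p'"]) (simp add: field_simps)
qed

lemma rat_on_diff: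
  assumes "rat_on Z f" "rat_on Z g" shows "rat_on Z (\<lambda>s. f s - g s)"
  using rat_on_add[OF assms(1) rat_on_mult[OF rat_on_const[of Z "-1"] assms(2)]] by simp

lemma rat_on_sum: "(\<And>i. i \<in> I \<Longrightarrow> rat_on Z (f i)) \<Longrightarrow> rat_on Z (\<lambda>s. \<Sum>i\<in>I. f i s)"
  by (induction I rule: infinite_finite_induct) (auto intro: rat_on_add rat_on_const)

lemma rat_on_prod: "(\<And>i. i \<in> I \<Longrightarrow> rat_on Z (f i)) \<Longrightarrow> rat_on Z (\<lambda>s. \<Prod>i\<in>I. f i s)"
  by (induction I rule: infinite_finite_induct) (auto intro: rat_on_mult rat_on_const)

lemma rat_on_matrix_mult:
  assumes "\<And>i j. rat_on Z (\<lambda>s. A s $ i $ j)" "\<And>i j. rat_on Z (\<lambda>s. B s $ i $ j)"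
  shows "rat_on Z (\<lambda>s. (A s ** B s) $ i $ j)"
  unfolding matrix_matrix_mult_def by (simp add: rat_on_sum rat_on_mult assms)

lemma rat_on_det:
  assumes "\<And>i j. rat_on Z (\<lambda>s. A s $ i $ j)"
  shows "rat_on Z (\<lambda>s. det (A s))"
  unfolding det_def by (intro rat_on_sum rat_on_mult rat_on_prod rat_on_const assms)

text \<open>Cramer's rule: the solution is a quotient of determinants whose denominator has no zero on \<open>Z\<close>.
  The conclusion yields one rational \<open>u\<close> on all of \<open>Z\<close>, to which a solution that is known only at
  some points of \<open>Z\<close> can be compared.\<close>

lemma rat_on_linear_solve:
  fixes M :: "complex \<Rightarrow> complex^'N^'N::finite"
  assumes "\<And>i j. rat_on Z (\<lambda>s. M s $ i $ j)" "\<And>s. s \<in> Z \<Longrightarrow> det (M s) \<noteq> 0"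
    and "\<And>i. rat_on Z (\<lambda>s. v s $ i)"
  obtains u where "\<And>i. rat_on Z (\<lambda>s. u s $ i)"
    and "\<And>s w. s \<in> Z \<Longrightarrow> M s *v w = v s \<Longrightarrow> w = u s"
proof
  define u where "u s = (\<chi> k. det (\<chi> i j. if j = k then v s $ i else M s $ i $ j) / det (M s))" for s
  have entries: "rat_on Z (\<lambda>s. (\<chi> i j. if j = k then v s $ i else M s $ i $ j) $ i $ j)" for i j k
    using assms by (cases "j = k") auto
  show "rat_on Z (\<lambda>s. u s $ i)" for i
    unfolding u_def using rat_on_divide[OF rat_on_det[OF entries] rat_on_det[OF assms(1)] assms(2)] by simp
  show "w = u s" if "s \<in> Z" "M s *v w = v s" for s w
    using cramer[OF assms(2)[OF that(1)]] that(2) by (simp add: u_def)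
qed

section \<open>The supremum norm bounds the gain on the closed right half plane\<close>

abbreviation closed_rhp :: "complex set" where "closed_rhp \<equiv> {s. 0 \<le> Re s}"

lemma RHinf_rat_on: "g \<in> RHinf \<Longrightarrow> rat_on closed_rhp g"
  unfolding RHinf_def rat_on_def by blast

lemma rat_on_continuous:
  assumes "rat_on Z g" shows "continuous_on Z g"
proof -
  obtain p q where pq: "\<forall>s\<in>Z. poly q s \<noteq> 0 \<and> g s = poly p s / poly q s"
    using assms unfolding rat_on_def by blast
  have "continuous_on Z (\<lambda>s. poly p s / poly q s)"
    using pq by (intro continuous_intros) auto
  also have "continuous_on Z (\<lambda>s. poly p s / poly q s) \<longleftrightarrow> continuous_on Z g"
    using pq by (intro continuous_on_cong) auto
  finally show ?thesis .
qed

text \<open>Properness bounds the quotient near infinity, and continuity bounds it on the compact rest of the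
  half plane. The bound is what makes the supremum in \<open>hinf_norm\<close> meaningful.\<close>

lemma RHinf_bounded:
  assumes "g \<in> RHinf" shows "\<exists>B. \<forall>s\<in>closed_rhp. norm (g s) \<le> B"
proof -
  obtain p q :: "real poly" where deg: "degree p \<le> degree q"
    and q: "\<forall>s. 0 \<le> Re s \<longrightarrow> poly (map_poly complex_of_real q) s \<noteq> 0"
    and g: "\<forall>s. poly (map_poly complex_of_real q) s \<noteq> 0 \<longrightarrow>
         g s = poly (map_poly complex_of_real p) s / poly (map_poly complex_of_real q) s"
    using assms unfolding RHinf_def by blast
  define P where "P = map_poly complex_of_real p"
  define Q where "Q = map_poly complex_of_real q"
  have degPQ: "degree P \<le> degree Q" unfolding P_def Q_def using deg by (simp add: degree_map_poly)
  have Q0: "Q \<noteq> 0" using q[rule_format, of 0] unfolding Q_def by auto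
  have limP: "((\<lambda>x. poly P x / x ^ degree P) \<longlongrightarrow> lead_coeff P) at_infinity"
    by (rule poly_divide_tendsto_aux)
  have limQ: "((\<lambda>x. poly Q x / x ^ degree Q) \<longlongrightarrow> lead_coeff Q) at_infinity"
    by (rule poly_divide_tendsto_aux)
  have "\<forall>\<^sub>F x in at_infinity. norm (poly P x / x ^ degree P) < norm (lead_coeff P) + 1"
    by (rule order_tendstoD[OF tendsto_norm[OF limP]]) simp
  moreover have "\<forall>\<^sub>F x in at_infinity. norm (poly Q x / x ^ degree Q) > norm (lead_coeff Q) / 2"
    by (rule order_tendstoD[OF tendsto_norm[OF limQ]]) (use Q0 in simp)
  ultimately have "\<forall>\<^sub>F x in at_infinity. norm (poly P x / x ^ degree P) < norm (lead_coeff P) + 1 \<and>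
      norm (poly Q x / x ^ degree Q) > norm (lead_coeff Q) / 2"
    by (rule eventually_conj)
  then obtain R where R: "\<And>x. R \<le> norm x \<Longrightarrow> norm (poly P x / x ^ degree P) < norm (lead_coeff P) + 1 \<and>
      norm (poly Q x / x ^ degree Q) > norm (lead_coeff Q) / 2"
    unfolding eventually_at_infinity by blast
  define R' where "R' = max R 1"
  have "compact (cball 0 R' \<inter> closed_rhp)"
    by (intro compact_Int_closed compact_cball closed_Collect_le continuous_intros)
  moreover have "continuous_on (cball 0 R' \<inter> closed_rhp) g"
    by (rule continuous_on_subset[OF rat_on_continuous[OF RHinf_rat_on[OF assms]]]) simp
  ultimately have "bounded (g ` (cball 0 R' \<inter> closed_rhp))"
    by (intro compact_imp_bounded compact_continuous_image)
  then obtain B1 where B1: "\<And>s. s \<in> cball 0 R' \<inter> closed_rhp \<Longrightarrow> norm (g s) \<le> B1"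
    unfolding bounded_iff by blast
  define B2 where "B2 = (norm (lead_coeff P) + 1) / (norm (lead_coeff Q) / 2)"
  have "norm (g s) \<le> max B1 B2" if s: "s \<in> closed_rhp" for s
  proof (cases "norm s \<le> R'")
    case True
    then show ?thesis using B1[of s] s by auto
  next
    case False
    then have ns: "R \<le> norm s" "1 \<le> norm s" by (auto simp: R'_def)
    have "norm (poly P s) \<le> (norm (lead_coeff P) + 1) * norm s ^ degree P"
    proof -
      have "norm s ^ degree P > 0" using ns(2) by (intro zero_less_power) linarith
      then show ?thesis using R[OF ns(1)] by (simp add: norm_divide norm_power divide_less_eq)
    qed
    also have "\<dots> \<le> (norm (lead_coeff P) + 1) * norm s ^ degree Q"
      using ns(2) degPQ by (intro mult_left_mono power_increasing) auto
    finally have P: "norm (poly P s) \<le> (norm (lead_coeff P) + 1) * norm s ^ degree Q" .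
    have sp: "norm s ^ degree Q > 0" using ns(2) by (intro zero_less_power) linarith
    have Q: "norm (lead_coeff Q) / 2 * norm s ^ degree Q \<le> norm (poly Q s)"
      using R[OF ns(1)] sp by (simp add: norm_divide norm_power less_divide_eq)
    have lc: "norm (lead_coeff Q) > 0" using Q0 by simp
    have "g s = poly P s / poly Q s" using g q s unfolding P_def Q_def by simp
    then have "norm (g s) = norm (poly P s) / norm (poly Q s)" by (simp add: norm_divide)
    also have "\<dots> \<le> ((norm (lead_coeff P) + 1) * norm s ^ degree Q) / (norm (lead_coeff Q) / 2 * norm s ^ degree Q)"
      by (rule frac_le[OF _ P _ Q]) (use lc sp in auto)
    also have "\<dots> = B2" unfolding B2_def using less_imp_neq[OF sp] by (simp only: mult_divide_mult_cancel_right)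
    finally show ?thesis by simp
  qed
  then show ?thesis by blast
qed

lemma norm_matrix_mult_le_entries:
  fixes A :: "complex^'N::finite^'M::finite"
  shows "norm (A *v v) \<le> (\<Sum>i\<in>UNIV. \<Sum>j\<in>UNIV. norm (A $ i $ j)) * norm v"
proof -
  have "norm (A *v v) \<le> (\<Sum>i\<in>UNIV. norm ((A *v v) $ i))"
    by (simp add: norm_vec_def L2_set_le_sum)
  also have "\<dots> \<le> (\<Sum>i\<in>UNIV. \<Sum>j\<in>UNIV. norm (A $ i $ j) * norm v)"
  proof (rule sum_mono)
    fix i
    have "norm ((A *v v) $ i) \<le> (\<Sum>j\<in>UNIV. norm (A $ i $ j * v $ j))"
      unfolding matrix_vector_mult_def by (simp add: norm_sum)
    also have "\<dots> \<le> (\<Sum>j\<in>UNIV. norm (A $ i $ j) * norm v)"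
      by (intro sum_mono) (simp add: norm_mult mult_left_mono Finite_Cartesian_Product.norm_nth_le)
    finally show "norm ((A *v v) $ i) \<le> (\<Sum>j\<in>UNIV. norm (A $ i $ j) * norm v)" .
  qed
  finally show ?thesis by (simp add: sum_distrib_right)
qed

text \<open>The norm is a supremum over the open half plane only. The bound extends to the imaginary axis, in
  particular to \<open>s = 0\<close>, by continuity.\<close>

lemma hinf_norm_bound:
  fixes G :: "complex \<Rightarrow> complex^'N::finite^'M::finite"
  assumes G: "G \<in> RHinf_mat"
  shows "0 \<le> hinf_norm G"
    and "0 \<le> Re s \<Longrightarrow> norm (G s *v v) \<le> hinf_norm G * norm v"
proof -
  have entry: "(\<lambda>s. G s $ i $ j) \<in> RHinf" for i j
    using G by (simp add: RHinf_mat_def)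
  then have "\<forall>i j. \<exists>B. \<forall>s\<in>closed_rhp. norm (G s $ i $ j) \<le> B"
    using RHinf_bounded by blast
  then obtain B where B: "\<And>i j s. s \<in> closed_rhp \<Longrightarrow> norm (G s $ i $ j) \<le> B i j"
    by metis
  have lin: "bounded_linear (\<lambda>v. G s *v v)" for s
  proof (rule bounded_linear_intro)
    show "norm (G s *v v) \<le> norm v * (\<Sum>i\<in>UNIV. \<Sum>j\<in>UNIV. norm (G s $ i $ j))" for v
      using norm_matrix_mult_le_entries[of "G s" v] by (simp add: mult.commute)
    show "G s *v (c *\<^sub>R v) = c *\<^sub>R (G s *v v)" for c v
      by (simp add: vec_eq_iff matrix_vector_mult_def scaleR_sum_right)
  qed (rule matrix_vector_right_distrib)
  have "onorm (\<lambda>v. G s *v v) \<le> (\<Sum>i\<in>UNIV. \<Sum>j\<in>UNIV. B i j)" if "s \<in> {s. 0 < Re s}" for s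
  proof (rule onorm_le)
    fix v
    have "norm (G s *v v) \<le> (\<Sum>i\<in>UNIV. \<Sum>j\<in>UNIV. norm (G s $ i $ j)) * norm v"
      by (rule norm_matrix_mult_le_entries)
    also have "\<dots> \<le> (\<Sum>i\<in>UNIV. \<Sum>j\<in>UNIV. B i j) * norm v"
      using that by (intro mult_right_mono sum_mono B) auto
    finally show "norm (G s *v v) \<le> (\<Sum>i\<in>UNIV. \<Sum>j\<in>UNIV. B i j) * norm v" .
  qed
  then have bdd: "bdd_above ((\<lambda>s. onorm (\<lambda>v. G s *v v)) ` {s. 0 < Re s})"
    by (intro bdd_aboveI2) blast
  have le: "onorm (\<lambda>v. G s *v v) \<le> hinf_norm G" if "0 < Re s" for s
    unfolding hinf_norm_def using that by (intro cSUP_upper bdd) simp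
  show "0 \<le> hinf_norm G"
    using le[of 1] onorm_pos_le[OF lin[of 1]] by simp
  have open_bound: "norm (G s *v v) \<le> hinf_norm G * norm v" if "0 < Re s" for s
    using onorm[OF lin, of s v] mult_right_mono[OF le[OF that] norm_ge_zero[of v]] by linarith
  show "norm (G s *v v) \<le> hinf_norm G * norm v" if s: "0 \<le> Re s"
  proof -
    define \<sigma> where "\<sigma> m = s + of_real (inverse (real (Suc m)))" for m
    have "(\<lambda>m. of_real (inverse (real (Suc m))) :: complex) \<longlonglongrightarrow> of_real 0"
      by (intro tendsto_of_real LIMSEQ_inverse_real_of_nat)
    then have \<sigma>: "\<sigma> \<longlonglongrightarrow> s" unfolding \<sigma>_def by (auto intro: tendsto_eq_intros)
    have pos: "0 < Re (\<sigma> m)" for m using s by (simp add: \<sigma>_def add_nonneg_pos)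
    have lim: "(\<lambda>m. G (\<sigma> m) $ i $ j) \<longlonglongrightarrow> G s $ i $ j" for i j
    proof (rule continuous_on_tendsto_compose[OF rat_on_continuous[OF RHinf_rat_on[OF entry]] \<sigma>])
      show "s \<in> closed_rhp" using s by simp
      show "\<forall>\<^sub>F m in sequentially. \<sigma> m \<in> closed_rhp" using pos by (simp add: less_imp_le)
    qed
    have "(\<lambda>m. G (\<sigma> m) *v v) \<longlonglongrightarrow> G s *v v"
      unfolding matrix_vector_mult_def
      by (rule vec_tendstoI, unfold vec_lambda_beta) (intro tendsto_sum tendsto_mult tendsto_const lim)
    then have "(\<lambda>m. norm (G (\<sigma> m) *v v)) \<longlonglongrightarrow> norm (G s *v v)" by (rule tendsto_norm)
    then show ?thesis
      by (rule LIMSEQ_le_const2) (intro exI allI impI open_bound pos)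
  qed
qed

section \<open>Disagreement through the factors of the product\<close>

text \<open>The equation determines \<open>s y\<^sub>r - a\<close> and \<open>z\<close> as the solution of the linear system of the
  pencil with right-hand side \<open>v\<close>, because the pencil maps the unit vector of \<open>r\<close> to \<open>G 1\<close>. Thus the
  possibly unstable part \<open>a G 1\<close> of the right-hand side affects only the common component \<open>y\<^sub>r\<close>,
  where the division by \<open>s\<close> creates a pole at zero.\<close>

lemma serial_factor_step:
  fixes K :: "complex^'N^'N::finite" and y v :: "complex \<Rightarrow> complex^'N"
  assumes GH: "\<And>i j. rat_on Z (\<lambda>s. G s $ i $ j)" "\<And>i j. rat_on Z (\<lambda>s. H s $ i $ j)"
    and det: "\<And>s. s \<in> Z \<Longrightarrow> det (split_pencil r (G s) (H s) K s) \<noteq> 0"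
    and K: "K *v (\<chi> i. 1) = 0"
    and D: "D \<subseteq> Z" "0 \<notin> D"
    and v: "\<And>i. rat_on Z (\<lambda>s. v s $ i)" and a: "rat_on D a"
    and eq: "\<And>s. s \<in> D \<Longrightarrow> (mat s ** G s + H s ** K) *v y s = v s + a s *s (G s *v (\<chi> i. 1))"
  shows "\<exists>u. (\<forall>i. rat_on Z (\<lambda>s. u s $ i)) \<and> (\<forall>s\<in>D. \<forall>i. y s $ i = y s $ r + u s $ i)"
    and "rat_on D (\<lambda>s. y s $ r)"
proof -
  let ?M = "\<lambda>s. split_pencil r (G s) (H s) K s"
  have "rat_on Z (\<lambda>s. (\<chi> i j. if j = r then 1 else if i = j then s else 0) $ i $ j)" for i j
    by (cases "j = r"; cases "i = j") (simp_all add: rat_on_const rat_on_ident)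
  then have M: "rat_on Z (\<lambda>s. ?M s $ i $ j)" for i j
    unfolding split_pencil_def vector_add_component
    by (intro rat_on_add rat_on_matrix_mult GH rat_on_const) auto
  obtain u where u: "\<And>i. rat_on Z (\<lambda>s. u s $ i)"
    and solve: "\<And>s w. s \<in> Z \<Longrightarrow> ?M s *v w = v s \<Longrightarrow> w = u s"
    by (rule rat_on_linear_solve[of Z ?M v]) (use M det v in blast)+
  have comp: "s * y s $ r - a s = u s $ r \<and> (\<forall>i. i \<noteq> r \<longrightarrow> y s $ i - y s $ r = u s $ i)" if s: "s \<in> D" for s
  proof -
    define z where "z = (\<chi> i. y s $ i - y s $ r)"
    \<comment> \<open>Subtracting \<open>a\<close> from the unknown in component \<open>r\<close> removes \<open>a G 1\<close> from the right-hand side.\<close>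
    define w where "w = (\<chi> i. if i = r then s * y s $ r - a s else z $ i)"
    have z: "(\<chi> i. if i = r then 0 else w $ i) = z"
      by (simp add: vec_eq_iff w_def z_def)
    have y: "y s = z + y s $ r *s (\<chi> i. 1)"
      by (simp add: vec_eq_iff z_def)
    have Kz: "K *v z = K *v y s"
    proof -
      have "K *v (y s $ r *s (\<chi> i. 1)) = 0"
        using vector_scalar_commute[of K "y s $ r" "\<chi> i. 1"] K by simp
      then show ?thesis
        by (subst y) (simp only: matrix_vector_right_distrib add_0_right)
    qed
    have p: "(\<chi> i. w $ r + s * z $ i) = s *s y s - a s *s (\<chi> i. 1)"
      by (simp add: vec_eq_iff w_def z_def algebra_simps)
    have "?M s *v w = G s *v (s *s y s) - a s *s (G s *v (\<chi> i. 1)) + H s *v (K *v y s)"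
      unfolding split_pencil_mult z p Kz
      by (simp only: matrix_vector_mult_diff_distrib vector_scalar_commute)
    also have "\<dots> = (mat s ** G s + H s ** K) *v y s - a s *s (G s *v (\<chi> i. 1))"
    proof -
      have "mat s *v (G s *v y s) = s *s (G s *v y s)"
        by (simp add: vec_eq_iff matrix_vector_mult_def mat_def if_distrib[of "\<lambda>x. x * _"] cong: if_cong)
      then show ?thesis
        by (simp add: matrix_vector_mult_add_rdistrib matrix_vector_mul_assoc[symmetric] vector_scalar_commute)
    qed
    also have "\<dots> = v s" using eq[OF s] by simp
    finally have "w = u s" using solve s D by blast
    then have w: "w $ i = u s $ i" for i by simp
    show ?thesis
    proof (intro conjI allI impI)
      show "s * y s $ r - a s = u s $ r" using w[of r] by (simp add: w_def)
      show "y s $ i - y s $ r = u s $ i" if "i \<noteq> r" for i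
        using w[of i] that by (simp add: w_def z_def)
    qed
  qed
  define u' where "u' s = (\<chi> i. if i = r then 0 else u s $ i)" for s
  have "rat_on Z (\<lambda>s. u' s $ i)" for i
    unfolding u'_def by (cases "i = r") (simp_all add: u rat_on_const)
  moreover have "y s $ i = y s $ r + u' s $ i" if "s \<in> D" for s i
    using comp[OF that] unfolding u'_def by (auto simp: algebra_simps)
  ultimately show "\<exists>u. (\<forall>i. rat_on Z (\<lambda>s. u s $ i)) \<and> (\<forall>s\<in>D. \<forall>i. y s $ i = y s $ r + u s $ i)"
    by blast
  have "rat_on D (\<lambda>s. (u s $ r + a s) / s)"
    using D by (intro rat_on_divide rat_on_add a rat_on_ident rat_on_subset[OF u]) auto
  moreover have "(u s $ r + a s) / s = y s $ r" if "s \<in> D" for s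
  proof -
    have "s \<noteq> 0" using D that by blast
    moreover have "s * y s $ r - a s = u s $ r" using comp[OF that] by (rule conjunct1)
    then have "u s $ r + a s = s * y s $ r" by (metis diff_add_cancel)
    ultimately show ?thesis by (metis nonzero_mult_div_cancel_left)
  qed
  ultimately show "rat_on D (\<lambda>s. y s $ r)"
    by (rule rat_on_cong[THEN iffD1, rotated])
qed

text \<open>The disagreement with vertex \<open>r\<close> agrees on \<open>D\<close> with a function that is rational without poles
  on the larger set \<open>Z\<close>, while the common component is only required to be rational on \<open>D\<close>.\<close>

definition disagreement_rat_on ::
  "'N \<Rightarrow> complex set \<Rightarrow> complex set \<Rightarrow> (complex \<Rightarrow> complex^'N::finite) \<Rightarrow> bool" where
  "disagreement_rat_on r Z D y \<longleftrightarrow>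
     (\<exists>u. (\<forall>i. rat_on Z (\<lambda>s. u s $ i)) \<and> (\<forall>s\<in>D. \<forall>i. y s $ i = y s $ r + u s $ i)) \<and>
     rat_on D (\<lambda>s. y s $ r)"

lemma disagreement_through_product:
  assumes "\<And>k y. k \<in> set ks \<Longrightarrow> disagreement_rat_on r Z D (\<lambda>s. A s k *v y s) \<Longrightarrow> disagreement_rat_on r Z D y"
    and "disagreement_rat_on r Z D (\<lambda>s. ordered_prod (A s) ks *v y s)"
  shows "disagreement_rat_on r Z D y"
  using assms
proof (induction ks)
  case Nil
  then show ?case by (simp add: ordered_prod_def)
next
  case (Cons k ks)
  have "ordered_prod (A s) (k # ks) *v y s = A s k *v (ordered_prod (A s) ks *v y s)" for s
    by (simp add: ordered_prod_def matrix_vector_mul_assoc)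
  then have "disagreement_rat_on r Z D (\<lambda>s. A s k *v (ordered_prod (A s) ks *v y s))"
    using Cons.prems(2) by (simp only:)
  then have "disagreement_rat_on r Z D (\<lambda>s. ordered_prod (A s) ks *v y s)"
    by (rule Cons.prems(1)[of k, rotated]) simp
  moreover have "disagreement_rat_on r Z D y'"
    if "k' \<in> set ks" "disagreement_rat_on r Z D (\<lambda>s. A s k' *v y' s)" for k' y'
    using that by (intro Cons.prems(1)[of k' y']) simp_all
  ultimately show ?case by (rule Cons.IH[rotated])
qed

lemma perturbation_entries:
  assumes "\<Delta> \<in> RHinf_mat"
  shows "rat_on closed_rhp (\<lambda>s. (mat 1 + \<Delta> s) $ i $ j)"
proof -
  have "rat_on closed_rhp (\<lambda>s. \<Delta> s $ i $ j)"
    using assms by (intro RHinf_rat_on) (simp add: RHinf_mat_def)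
  from rat_on_add[OF rat_on_const[of closed_rhp "mat 1 $ i $ j"] this]
  show ?thesis by simp
qed

text \<open>Here \<open>G\<close> is the identity, so the common component of the right-hand side is a multiple of
  \<open>G 1\<close> as \<open>serial_factor_step\<close> requires.\<close>

lemma disagreement_through_factor:
  fixes W :: "real^'N::finite^'N" and \<Delta> :: "complex \<Rightarrow> complex^'N^'N"
  defines "K \<equiv> map_matrix complex_of_real (graph_laplacian W)"
  assumes graph: "adjacency_matrix E W" "connected_spanning_tree E"
    and sym: "graph_laplacian W = transpose (graph_laplacian W)"
    and \<Delta>: "\<Delta> \<in> RHinf_mat" "hinf_norm \<Delta> < 1"
    and D: "D \<subseteq> closed_rhp" "0 \<notin> D"
    and u: "disagreement_rat_on r closed_rhp D (\<lambda>s. (mat s + (mat 1 + \<Delta> s) ** K) *v y s)"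
  shows "disagreement_rat_on r closed_rhp D y"
proof -
  obtain v where v: "\<And>i. rat_on closed_rhp (\<lambda>s. v s $ i)"
    and split: "\<And>s i. s \<in> D \<Longrightarrow> ((mat s + (mat 1 + \<Delta> s) ** K) *v y s) $ i
        = ((mat s + (mat 1 + \<Delta> s) ** K) *v y s) $ r + v s $ i"
    and ref: "rat_on D (\<lambda>s. ((mat s + (mat 1 + \<Delta> s) ** K) *v y s) $ r)"
    using u unfolding disagreement_rat_on_def by blast
  have one: "rat_on closed_rhp (\<lambda>s. (mat 1 :: complex^'N^'N) $ i $ j)" for i j
    by (rule rat_on_const)
  have det: "det (split_pencil r (mat 1) (mat 1 + \<Delta> s) K s) \<noteq> 0" if "s \<in> closed_rhp" for s
  proof -
    have "det (split_pencil r (mat 1 + 0) (mat 1 + \<Delta> s) K s) \<noteq> 0"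
      unfolding K_def
    proof (rule split_pencil_nonsingular[OF graph sym, where a = 0 and b = "hinf_norm \<Delta>"])
      show "norm (\<Delta> s *v v) \<le> hinf_norm \<Delta> * norm v" for v
        using that by (intro hinf_norm_bound \<Delta>) simp
    qed (use that \<Delta>(2) hinf_norm_bound(1)[OF \<Delta>(1)] in simp_all)
    then show ?thesis by simp
  qed
  have eq: "(mat s ** mat 1 + (mat 1 + \<Delta> s) ** K) *v y s
      = v s + ((mat s + (mat 1 + \<Delta> s) ** K) *v y s) $ r *s (mat 1 *v (\<chi> i. 1))" if "s \<in> D" for s
  proof (rule vec_eq_iff[THEN iffD2, rule_format])
    fix i
    show "((mat s ** mat 1 + (mat 1 + \<Delta> s) ** K) *v y s) $ i
        = (v s + ((mat s + (mat 1 + \<Delta> s) ** K) *v y s) $ r *s (mat 1 *v (\<chi> i. 1))) $ i"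
      unfolding matrix_mul_rid matrix_vector_mul_lid vector_add_component vector_smult_component
        vec_lambda_beta mult_1_right
      by (subst split[OF that]) (rule add.commute)
  qed
  have "K *v (\<chi> i. 1) = 0"
    unfolding K_def by (simp add: vec_eq_iff laplacian_mult_component)
  note step = serial_factor_step[where G = "\<lambda>s. mat 1", OF one perturbation_entries[OF \<Delta>(1)] det this D v ref eq]
  show ?thesis unfolding disagreement_rat_on_def by (rule conjI[OF step])
qed

text \<open>For this factor \<open>G = I + \<Delta>\<^sub>0\<close> does not fix the all-ones vector, so the right-hand side may not
  contain an unstable common component. This is harmless since the factor is leftmost and acts on
  a stable input.\<close>

lemma disagreement_through_leading_factor:
  fixes W :: "real^'N::finite^'N" and \<Delta>0 \<Delta> :: "complex \<Rightarrow> complex^'N^'N"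
  defines "K \<equiv> map_matrix complex_of_real (graph_laplacian W)"
  assumes graph: "adjacency_matrix E W" "connected_spanning_tree E"
    and sym: "graph_laplacian W = transpose (graph_laplacian W)"
    and \<Delta>: "\<Delta>0 \<in> RHinf_mat" "\<Delta> \<in> RHinf_mat" "hinf_norm \<Delta>0 + hinf_norm \<Delta> < 1"
    and D: "D \<subseteq> closed_rhp" "0 \<notin> D"
    and U: "U \<in> RHinf_vec" "\<And>s. s \<in> D \<Longrightarrow> (mat s + mat s ** \<Delta>0 s + (mat 1 + \<Delta> s) ** K) *v y s = U s"
  shows "disagreement_rat_on r closed_rhp D y"
proof -
  have det: "det (split_pencil r (mat 1 + \<Delta>0 s) (mat 1 + \<Delta> s) K s) \<noteq> 0" if "s \<in> closed_rhp" for s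
    unfolding K_def
  proof (rule split_pencil_nonsingular[OF graph sym, where a = "hinf_norm \<Delta>0" and b = "hinf_norm \<Delta>"])
    show "norm (\<Delta>0 s *v v) \<le> hinf_norm \<Delta>0 * norm v" "norm (\<Delta> s *v v) \<le> hinf_norm \<Delta> * norm v" for v
      using that by (auto intro!: hinf_norm_bound \<Delta>)
  qed (use that \<Delta>(3) hinf_norm_bound(1)[OF \<Delta>(1)] hinf_norm_bound(1)[OF \<Delta>(2)] in simp_all)
  have v: "rat_on closed_rhp (\<lambda>s. U s $ i)" for i
    using U(1) by (intro RHinf_rat_on) (simp add: RHinf_vec_def)
  have eq: "(mat s ** (mat 1 + \<Delta>0 s) + (mat 1 + \<Delta> s) ** K) *v y s
      = U s + 0 *s ((mat 1 + \<Delta>0 s) *v (\<chi> i. 1))" if "s \<in> D" for s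
    using U(2)[OF that] by (simp add: matrix_add_ldistrib)
  have "K *v (\<chi> i. 1) = 0"
    unfolding K_def by (simp add: vec_eq_iff laplacian_mult_component)
  note step = serial_factor_step[where a = "\<lambda>s. 0", OF perturbation_entries[OF \<Delta>(1)]
      perturbation_entries[OF \<Delta>(2)] det this D v rat_on_const eq]
  show ?thesis unfolding disagreement_rat_on_def by (rule conjI[OF step])
qed

section \<open>Integrals over the half line\<close>

text \<open>Over the half line the Henstock--Kurzweil integral is the improper integral, which lets
  conditionally convergent Laplace integrals be handled through their truncations.\<close>

lemma has_integral_halfline_iff:
  fixes f :: "real \<Rightarrow> 'a::banach"
  shows "(f has_integral I) {0..} \<longleftrightarrow>
    (\<forall>T. f integrable_on {0..T}) \<and> ((\<lambda>T. integral {0..T} f) \<longlongrightarrow> I) at_top"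
proof
  assume f: "(f has_integral I) {0..}"
  have int: "f integrable_on {0..T}" for T
    using f by (intro integrable_on_subinterval[of f "{0..}"]) (auto simp: integrable_on_def)
  have "\<forall>\<^sub>F T in at_top. dist (integral {0..T} f) I < e" if "e > 0" for e
  proof -
    obtain B where B: "B > 0" "\<And>a b. ball 0 B \<subseteq> cbox a b \<Longrightarrow>
        norm (integral (cbox a b) (\<lambda>x. if x \<in> {0..} then f x else 0) - I) < e"
      using f \<open>e > 0\<close> unfolding has_integral_alt'[of f I] by blast
    have "dist (integral {0..T} f) I < e" if "T \<ge> B" for T
    proof -
      have "ball 0 B \<subseteq> cbox (-T) T" using that by (auto simp: dist_real_def)
      then have "norm (integral ({0..} \<inter> cbox (- T) T) f - I) < e"
        using B(2)[of "-T" T] by (simp only: integral_restrict_Int)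
      moreover have "{0..} \<inter> cbox (- T) T = {0..T}" using that B(1) by auto
      ultimately show ?thesis by (simp only: dist_norm)
    qed
    then show ?thesis unfolding eventually_at_top_linorder by blast
  qed
  then show "(\<forall>T. f integrable_on {0..T}) \<and> ((\<lambda>T. integral {0..T} f) \<longlongrightarrow> I) at_top"
    using int by (auto intro: tendstoI)
next
  assume *: "(\<forall>T. f integrable_on {0..T}) \<and> ((\<lambda>T. integral {0..T} f) \<longlongrightarrow> I) at_top"
  show "(f has_integral I) {0..}"
    unfolding has_integral_alt'[of f I]
  proof (intro conjI allI impI)
    fix a b :: real
    have eq: "{0..} \<inter> cbox a b = {max a 0..b}" by auto
    have "f integrable_on {max a 0..b}"
      by (rule integrable_on_subinterval[of f "{0..b}"]) (use * in auto)
    then show "(\<lambda>x. if x \<in> {0..} then f x else 0) integrable_on cbox a b"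
      unfolding integrable_restrict_Int eq .
  next
    fix e :: real assume "e > 0"
    then obtain N where N: "\<And>T. T \<ge> N \<Longrightarrow> dist (integral {0..T} f) I < e"
      using * unfolding tendsto_iff eventually_at_top_linorder by blast
    define B where "B = max N 1"
    have "norm (integral (cbox a b) (\<lambda>x. if x \<in> {0..} then f x else 0) - I) < e"
      if "ball 0 B \<subseteq> cbox a b" for a b
    proof -
      have "{-B<..<B} \<subseteq> {a..b}" using that by (simp add: ball_eq_greaterThanLessThan)
      then have "a \<le> - B" "B \<le> b"
        by (auto simp: B_def greaterThanLessThan_subseteq_atLeastAtMost_iff)
      then have "{0..} \<inter> cbox a b = {0..b}" "N \<le> b" by (auto simp: B_def)
      then show ?thesis using N[of b] by (simp only: integral_restrict_Int dist_norm)
    qed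
    moreover have "B > 0" by (simp add: B_def)
    ultimately show "\<exists>B>0. \<forall>a b. ball 0 B \<subseteq> cbox a b \<longrightarrow>
        norm (integral (cbox a b) (\<lambda>x. if x \<in> {0..} then f x else 0) - I) < e" by blast
  qed
qed

lemma has_integral_halfline_ftc:
  fixes G :: "real \<Rightarrow> 'a::banach"
  assumes "continuous_on {0..} G" "\<And>t. t > 0 \<Longrightarrow> (G has_vector_derivative g t) (at t)"
    and "(G \<longlongrightarrow> L) at_top"
  shows "(g has_integral (L - G 0)) {0..}"
  unfolding has_integral_halfline_iff
proof (intro conjI allI)
  have ftc: "(g has_integral (G T - G 0)) {0..T}" if "0 \<le> T" for T
    using that assms(1,2)
    by (intro fundamental_theorem_of_calculus_interior) (auto intro: continuous_on_subset)
  show "g integrable_on {0..T}" for T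
    using ftc[of T] by (cases "0 \<le> T") (auto simp: integrable_on_def)
  have "\<forall>\<^sub>F T in at_top. G T - G 0 = integral {0..T} g"
    using eventually_ge_at_top[of 0] by eventually_elim (simp add: integral_unique[OF ftc])
  moreover have "((\<lambda>T. G T - G 0) \<longlongrightarrow> L - G 0) at_top"
    by (intro tendsto_intros assms(3))
  ultimately show "((\<lambda>T. integral {0..T} g) \<longlongrightarrow> L - G 0) at_top"
    by (rule Lim_transform_eventually[rotated])
qed

section \<open>Exponential polynomials\<close>

lemma exp_monomial_tendsto_0:
  assumes "Re l < 0"
  shows "((\<lambda>t. of_real t ^ j * exp (l * of_real t)) \<longlongrightarrow> 0) at_top"
proof (rule tendsto_norm_zero_cancel)
  define a where "a = - Re l"
  have a: "a > 0" and Re: "Re l = - a" using assms by (simp_all add: a_def)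
  have "filterlim (\<lambda>t. a * t) at_top at_top"
    by (rule filterlim_tendsto_pos_mult_at_top[OF tendsto_const a filterlim_ident])
  from filterlim_compose[OF tendsto_power_div_exp_0 this]
  have "((\<lambda>t. (a * t) ^ j / exp (a * t)) \<longlongrightarrow> 0) at_top" .
  then have "((\<lambda>t. inverse (a ^ j) * ((a * t) ^ j / exp (a * t))) \<longlongrightarrow> inverse (a ^ j) * 0) at_top"
    by (intro tendsto_mult tendsto_const)
  moreover have "\<forall>\<^sub>F t in at_top. inverse (a ^ j) * ((a * t) ^ j / exp (a * t))
      = norm (of_real t ^ j * exp (l * of_real t))"
    using eventually_ge_at_top[of 0]
    by eventually_elim
      (use a in \<open>simp add: norm_mult norm_power power_mult_distrib Re exp_minus field_simps\<close>)
  ultimately show "((\<lambda>t. norm (of_real t ^ j * exp (l * of_real t))) \<longlongrightarrow> 0) at_top"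
    by (simp add: tendsto_cong)
qed

text \<open>The functions \<open>t^j exp (l t)\<close> with exponents \<open>l\<close> in \<open>\<Lambda>\<close>, closed under linear
  combinations. Tracking the exponents transfers pole locations to the time domain.\<close>

inductive_set exp_poly :: "complex set \<Rightarrow> (real \<Rightarrow> complex) set" for \<Lambda> where
  zero: "(\<lambda>t. 0) \<in> exp_poly \<Lambda>"
| add_term: "h \<in> exp_poly \<Lambda> \<Longrightarrow> l \<in> \<Lambda> \<Longrightarrow>
    (\<lambda>t. h t + c * (of_real t ^ j * exp (l * of_real t))) \<in> exp_poly \<Lambda>"

lemma exp_poly_mono:
  assumes "h \<in> exp_poly \<Lambda>" "\<Lambda> \<subseteq> \<Lambda>'" shows "h \<in> exp_poly \<Lambda>'"
  using assms(1) by induction (use assms(2) in \<open>auto intro: exp_poly.intros\<close>)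

lemma exp_poly_derivative:
  assumes "h \<in> exp_poly \<Lambda>"
  shows "\<exists>h'\<in>exp_poly \<Lambda>. \<forall>t. (h has_vector_derivative h' t) (at t)"
  using assms
proof induction
  case zero
  then show ?case by (auto intro!: bexI[of _ "\<lambda>t. 0"] exp_poly.zero)
next
  case (add_term h l c j)
  then obtain h' where h': "h' \<in> exp_poly \<Lambda>" "\<And>t. (h has_vector_derivative h' t) (at t)" by blast
  define g where "g t = (h' t + (c * l) * (of_real t ^ j * exp (l * of_real t)))
      + (c * of_nat j) * (of_real t ^ (j - 1) * exp (l * of_real t))" for t
  have "g \<in> exp_poly \<Lambda>"
    unfolding g_def by (intro exp_poly.add_term h' add_term)
  moreover have "((\<lambda>t. h t + c * (of_real t ^ j * exp (l * of_real t))) has_vector_derivative g t) (at t)" for t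
  proof -
    have "((\<lambda>z. c * (z ^ j * exp (l * z))) has_field_derivative
        c * (of_nat j * of_real t ^ (j - 1) * exp (l * of_real t) + of_real t ^ j * (l * exp (l * of_real t))))
        (at (of_real t))"
      by (auto intro!: derivative_eq_intros simp: algebra_simps)
    from has_vector_derivative_add[OF h'(2) has_vector_derivative_real_field[OF this]]
    show ?thesis by (simp add: g_def algebra_simps)
  qed
  ultimately show ?case by blast
qed

lemma exp_poly_tendsto_0:
  assumes "h \<in> exp_poly \<Lambda>" "\<And>l. l \<in> \<Lambda> \<Longrightarrow> Re l < 0"
  shows "(h \<longlongrightarrow> 0) at_top"
  using assms(1)
proof induction
  case (add_term h l c j)
  have "((\<lambda>t. h t + c * (of_real t ^ j * exp (l * of_real t))) \<longlongrightarrow> 0 + c * 0) at_top"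
    by (intro tendsto_add tendsto_mult tendsto_const add_term exp_monomial_tendsto_0 assms)
  then show ?case by simp
qed simp

text \<open>Agreement is assumed for positive times only, since the transform does not see the value at zero;
  openness of that set suffices for differentiation.\<close>

lemma iterated_deriv_exp_poly:
  fixes g :: "real \<Rightarrow> real"
  assumes "h \<in> exp_poly \<Lambda>" "\<And>t. 0 < t \<Longrightarrow> g t = Re (h t)"
  shows "\<exists>h'\<in>exp_poly \<Lambda>. \<forall>t>0. (deriv ^^ k) g t = Re (h' t)"
    and "0 < t \<Longrightarrow> (deriv ^^ k) g differentiable (at t)"
proof -
  have step: "\<exists>h'\<in>exp_poly \<Lambda>. \<forall>t>0. (g has_real_derivative Re (h' t)) (at t)"
    if h: "h \<in> exp_poly \<Lambda>" and g: "\<And>t. 0 < t \<Longrightarrow> g t = Re (h t)" for g h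
  proof -
    obtain h' where h': "h' \<in> exp_poly \<Lambda>" "\<And>t. (h has_vector_derivative h' t) (at t)"
      using exp_poly_derivative[OF h] by blast
    have "(g has_real_derivative Re (h' t)) (at t)" if "0 < t" for t
    proof -
      have "((\<lambda>t. Re (h t)) has_real_derivative Re (h' t)) (at t)"
        unfolding has_real_derivative_iff_has_vector_derivative
        by (rule bounded_linear.has_vector_derivative[OF bounded_linear_Re h'(2)])
      then show ?thesis
        by (rule has_field_derivative_transform_within_open[of _ _ _ "{0<..}"]) (use that g in auto)
    qed
    then show ?thesis using h'(1) by blast
  qed
  show *: "\<exists>h'\<in>exp_poly \<Lambda>. \<forall>t>0. (deriv ^^ k) g t = Re (h' t)" for k
  proof (induction k)
    case (Suc k)
    then obtain h' where "h' \<in> exp_poly \<Lambda>" "\<And>t. 0 < t \<Longrightarrow> (deriv ^^ k) g t = Re (h' t)" by blast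
    from step[OF this] obtain h'' where "h'' \<in> exp_poly \<Lambda>"
      "\<And>t. 0 < t \<Longrightarrow> ((deriv ^^ k) g has_real_derivative Re (h'' t)) (at t)" by blast
    then show ?case by (auto intro!: bexI[of _ h''] DERIV_imp_deriv)
  qed (use assms in auto)
  show "(deriv ^^ k) g differentiable (at t)" if "0 < t"
    using *[of k] step[of _ "(deriv ^^ k) g"] that
    by (meson real_differentiable_def)
qed

lemma iterated_deriv_diff:
  fixes f g :: "real \<Rightarrow> real"
  assumes "\<And>k t. 0 < t \<Longrightarrow> (deriv ^^ k) f differentiable (at t)"
    and "\<And>k t. 0 < t \<Longrightarrow> (deriv ^^ k) g differentiable (at t)" and "0 < t"
  shows "(deriv ^^ k) (\<lambda>t. f t - g t) t = (deriv ^^ k) f t - (deriv ^^ k) g t"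
  using \<open>0 < t\<close>
proof (induction k arbitrary: t)
  case (Suc k)
  have "((\<lambda>t. (deriv ^^ k) f t - (deriv ^^ k) g t) has_real_derivative
      (deriv ^^ Suc k) f t - (deriv ^^ Suc k) g t) (at t)"
    using assms(1,2)[OF Suc.prems, of k]
    by (auto intro!: DERIV_diff simp: DERIV_deriv_iff_real_differentiable)
  then have "((deriv ^^ k) (\<lambda>t. f t - g t) has_real_derivative
      (deriv ^^ Suc k) f t - (deriv ^^ Suc k) g t) (at t)"
    by (rule has_field_derivative_transform_within_open[of _ _ _ "{0<..}"]) (use Suc in auto)
  then show ?case by (simp add: DERIV_imp_deriv)
qed simp

section \<open>Inverse transforms of strictly proper rational functions\<close>

text \<open>Only real arguments \<open>s\<close> are considered. They suffice to determine the function, and they turn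
  the kernel into a real factor.\<close>

definition has_laplace :: "(real \<Rightarrow> complex) \<Rightarrow> real \<Rightarrow> complex \<Rightarrow> bool" where
  "has_laplace f s F \<longleftrightarrow> ((\<lambda>t. exp (- (s * t)) *\<^sub>R f t) has_integral F) {0..}"

lemma has_laplace_add:
  "has_laplace f s F \<Longrightarrow> has_laplace g s G \<Longrightarrow> has_laplace (\<lambda>t. f t + g t) s (F + G)"
  unfolding has_laplace_def scaleR_add_right by (rule has_integral_add)

lemma has_laplace_diff:
  "has_laplace f s F \<Longrightarrow> has_laplace g s G \<Longrightarrow> has_laplace (\<lambda>t. f t - g t) s (F - G)"
  unfolding has_laplace_def scaleR_diff_right by (rule has_integral_diff)

text \<open>Instead of integrating by parts, the induction step differentiates the candidate \<open>G\<close>, whose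
  derivative is the integrand minus \<open>1/\<mu>\<close> times the integrand of one degree less and whose limits
  at both ends vanish.\<close>

lemma has_integral_exp_monomial:
  assumes "0 < Re \<mu>"
  shows "((\<lambda>t. of_real t ^ j / fact j * exp (- \<mu> * of_real t)) has_integral 1 / \<mu> ^ Suc j) {0..}"
proof (induction j)
  have \<mu>: "\<mu> \<noteq> 0" using assms by auto
  define G where "G j z = z ^ j / fact j * (- exp (- \<mu> * z) / \<mu>)" for j and z :: complex
  have cont: "continuous_on {0..} (\<lambda>t. G j (of_real t))" for j
    unfolding G_def using \<mu> by (intro continuous_intros) auto
  have lim: "((\<lambda>t. G j (of_real t)) \<longlongrightarrow> 0) at_top" for j
  proof -
    have "((\<lambda>t. (- 1 / (\<mu> * fact j)) * (of_real t ^ j * exp (- \<mu> * of_real t))) \<longlongrightarrow> (- 1 / (\<mu> * fact j)) * 0) at_top"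
      by (intro tendsto_mult tendsto_const exp_monomial_tendsto_0) (use assms in simp)
    moreover have "(- 1 / (\<mu> * fact j)) * (z ^ j * exp (- \<mu> * z)) = G j z" for z
      by (simp add: G_def)
    ultimately show ?thesis by (simp only: mult_zero_right)
  qed
  {
    case 0
    have "(G 0 has_field_derivative exp (- \<mu> * z)) (at z)" for z
      unfolding G_def using \<mu> by (auto intro!: derivative_eq_intros)
    then have "((\<lambda>t. G 0 (of_real t)) has_vector_derivative exp (- \<mu> * of_real t)) (at t)" for t
      by (rule has_vector_derivative_real_field)
    from has_integral_halfline_ftc[OF cont this lim] show ?case by (simp add: G_def)
  next
    case (Suc j)
    let ?e = "\<lambda>j t. of_real t ^ j / fact j * exp (- \<mu> * of_real t) :: complex"
    have deriv: "(G (Suc j) has_field_derivative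
        z ^ Suc j / fact (Suc j) * exp (- \<mu> * z) - (z ^ j / fact j * exp (- \<mu> * z)) / \<mu>) (at z)" for z
    proof -
      have "((\<lambda>z. z ^ Suc j / fact (Suc j)) has_field_derivative z ^ j / fact j) (at z)"
      proof -
        have "((\<lambda>z. z ^ Suc j / fact (Suc j)) has_field_derivative (of_nat (Suc j) * z ^ j) / fact (Suc j)) (at z)"
          using DERIV_power_Suc[OF DERIV_ident, where n = j]
          by (intro DERIV_cdivide) (simp del: power_Suc)
        moreover have "(of_nat (Suc j) * z ^ j) / fact (Suc j) = z ^ j / fact j"
          by (simp add: fact_Suc del: of_nat_Suc)
        ultimately show ?thesis by simp
      qed
      moreover have "((\<lambda>z. - exp (- \<mu> * z) / \<mu>) has_field_derivative exp (- \<mu> * z)) (at z)"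
        using \<mu> by (auto intro!: derivative_eq_intros)
      ultimately have "(G (Suc j) has_field_derivative
          z ^ j / fact j * (- exp (- \<mu> * z) / \<mu>) + exp (- \<mu> * z) * (z ^ Suc j / fact (Suc j))) (at z)"
        unfolding G_def by (rule DERIV_mult)
      moreover have "z ^ j / fact j * (- exp (- \<mu> * z) / \<mu>) + exp (- \<mu> * z) * (z ^ Suc j / fact (Suc j))
          = z ^ Suc j / fact (Suc j) * exp (- \<mu> * z) - (z ^ j / fact j * exp (- \<mu> * z)) / \<mu>"
        by (simp del: fact_Suc power_Suc)
      ultimately show ?thesis by (rule DERIV_cong)
    qed
    have "((\<lambda>t. G (Suc j) (of_real t)) has_vector_derivative ?e (Suc j) t - ?e j t / \<mu>) (at t)" for t
      by (rule has_vector_derivative_real_field[OF deriv])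
    from has_integral_halfline_ftc[OF cont this lim]
    have "((\<lambda>t. ?e (Suc j) t - ?e j t / \<mu>) has_integral (0 - G (Suc j) (of_real 0))) {0..}" .
    moreover have "G (Suc j) (of_real 0) = 0" by (simp add: G_def)
    ultimately have "((\<lambda>t. ?e (Suc j) t - ?e j t / \<mu>) has_integral 0) {0..}" by (simp only: diff_zero)
    from has_integral_add[OF this has_integral_divide[OF Suc, of \<mu>]]
    show ?case
      by (simp only: diff_add_cancel add_0_left divide_divide_eq_left power_Suc2[of \<mu> "Suc j"])
  }
qed

lemma has_laplace_exp_monomial:
  assumes "Re l < s"
  shows "has_laplace (\<lambda>t. a / fact j * (of_real t ^ j * exp (l * of_real t))) s (a / (of_real s - l) ^ Suc j)"
proof -
  have "((\<lambda>t. a * (of_real t ^ j / fact j * exp (- (of_real s - l) * of_real t))) has_integral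
      a * (1 / (of_real s - l) ^ Suc j)) {0..}"
    by (intro has_integral_mult_right has_integral_exp_monomial) (use assms in simp)
  moreover have "a * (of_real t ^ j / fact j * exp (- (of_real s - l) * of_real t))
      = exp (- (s * t)) *\<^sub>R (a / fact j * (of_real t ^ j * exp (l * of_real t)))" for t
    by (simp add: scaleR_conv_of_real exp_of_real[symmetric] algebra_simps mult_exp_exp)
  ultimately show ?thesis unfolding has_laplace_def by simp
qed

text \<open>Partial fractions by induction on the degree of \<open>q\<close>. If \<open>l\<close> is a root of order \<open>m + 1\<close> and
  \<open>r\<close> the cofactor, then subtracting \<open>(p l / r l) / (s - l)^(m+1)\<close> cancels one factor
  \<open>s - l\<close> of the denominator and keeps the remainder strictly proper.\<close>

lemma strictly_proper_inverse_laplace: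
  fixes p q :: "complex poly"
  assumes "q \<noteq> 0" "degree p < degree q \<or> p = 0"
  shows "\<exists>h\<in>exp_poly {l. poly q l = 0}. \<forall>s. (\<forall>l. poly q l = 0 \<longrightarrow> Re l < s) \<longrightarrow>
           has_laplace h s (poly p (of_real s) / poly q (of_real s))"
  using assms
proof (induction "degree q" arbitrary: p q)
  case 0
  then have "p = 0" by simp
  then show ?case
    by (intro bexI[of _ "\<lambda>t. 0"]) (auto simp: has_laplace_def intro: exp_poly.zero)
next
  case (Suc d)
  obtain l where l: "poly q l = 0"
    using fundamental_theorem_of_algebra[of q] constant_degree[of q] Suc(2) by auto
  obtain r where r: "q = [:- l, 1:] ^ order l q * r" "\<not> [:- l, 1:] dvd r"
    using order_decomp[OF Suc(3)] by blast
  obtain m where m: "order l q = Suc m"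
    using l Suc(3) order_root[of q l] not0_implies_Suc by blast
  have rl: "poly r l \<noteq> 0" using r(2) by (simp add: poly_eq_0_iff_dvd)
  define a where "a = poly p l / poly r l"
  have "poly (p - smult a r) l = 0" using rl by (simp add: a_def)
  then obtain p' where p': "p - smult a r = [:- l, 1:] * p'"
    unfolding poly_eq_0_iff_dvd by (rule dvdE)
  define q' where "q' = [:- l, 1:] ^ m * r"
  have q: "q = [:- l, 1:] * q'" using r(1) unfolding m q'_def power_Suc mult.assoc .
  have q'0: "q' \<noteq> 0" using q Suc(3) by auto
  have degq': "Suc (degree q') = degree q"
    unfolding q using q'0 by (subst degree_mult_eq) auto
  have degr: "degree r < degree q"
  proof -
    have "r \<noteq> 0" using rl by auto
    then have "degree q = Suc m + degree r"
      by (subst r(1)) (simp add: m degree_mult_eq degree_power_eq del: power_Suc)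
    then show ?thesis by simp
  qed
  have "degree p' < degree q' \<or> p' = 0"
  proof (cases "p' = 0")
    case False
    have "Suc (degree p') = degree (p - smult a r)"
      unfolding p' using False by (subst degree_mult_eq) auto
    also have "\<dots> < degree q"
      using Suc(2,4) degr by (intro degree_diff_less) auto
    finally show ?thesis using degq' by simp
  qed simp
  with Suc(1)[of q' p'] q'0 degq' Suc(2) obtain h where
    h: "h \<in> exp_poly {l. poly q' l = 0}"
    and hL: "\<And>s. (\<forall>l. poly q' l = 0 \<longrightarrow> Re l < s) \<Longrightarrow> has_laplace h s (poly p' (of_real s) / poly q' (of_real s))"
    by auto
  define g where "g t = h t + a / fact m * (of_real t ^ m * exp (l * of_real t))" for t
  have "h \<in> exp_poly {l. poly q l = 0}"
    by (rule exp_poly_mono[OF h]) (auto simp: q)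
  then have "g \<in> exp_poly {l. poly q l = 0}"
    unfolding g_def using l by (intro exp_poly.add_term) auto
  moreover have "has_laplace g s (poly p (of_real s) / poly q (of_real s))"
    if s: "\<forall>l. poly q l = 0 \<longrightarrow> Re l < s" for s
  proof -
    define z where "z = complex_of_real s"
    have z: "poly q z \<noteq> 0" using s[rule_format, of z] by (auto simp: z_def)
    then have z': "poly q' z \<noteq> 0" "z \<noteq> l" "poly r z \<noteq> 0" using q l by (auto simp: q'_def)
    have "poly p z = a * poly r z + (z - l) * poly p' z"
      using arg_cong[OF p', of "\<lambda>p. poly p z"] by (simp add: algebra_simps)
    have "poly [:- l, 1:] z = z - l" by simp
    then have "poly q z = (z - l) ^ Suc m * poly r z" "poly q' z = (z - l) ^ m * poly r z"
      by (simp_all only: q q'_def poly_mult poly_power power_Suc mult.assoc)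
    moreover have "poly q z = (z - l) * poly q' z"
      using \<open>poly [:- l, 1:] z = z - l\<close> by (simp only: q poly_mult)
    ultimately have "poly p' z / poly q' z = (z - l) * poly p' z / poly q z"
      "a / (z - l) ^ Suc m = a * poly r z / poly q z"
      using z' by simp_all
    then have "poly p' z / poly q' z + a / (z - l) ^ Suc m = poly p z / poly q z"
      unfolding \<open>poly p z = a * poly r z + (z - l) * poly p' z\<close> by (simp only: add_divide_distrib add.commute)
    moreover have "has_laplace g s (poly p' z / poly q' z + a / (z - l) ^ Suc m)"
      unfolding g_def z_def
      by (intro has_laplace_add hL has_laplace_exp_monomial) (use s l q in auto)
    ultimately show ?thesis by (simp add: z_def)
  qed
  ultimately show ?case by blast
qed

section \<open>Uniqueness of conditionally convergent Laplace transforms\<close>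

text \<open>Under \<open>u = exp (- t)\<close> the vanishing transforms at integer arguments say that
  \<open>\<phi> t = exp (- t) * g t\<close> is orthogonal, with weight \<open>exp (- t)\<close>, to all polynomials in \<open>u\<close>.
  Boundedness of \<open>g\<close> makes \<open>\<phi>\<close> a continuous function \<open>\<psi>\<close> of \<open>u\<close> on the closed unit
  interval, so by Weierstrass it is a uniform limit of such polynomials and hence orthogonal to
  itself.\<close>

lemma lerch_bounded_real:
  fixes g :: "real \<Rightarrow> real"
  assumes cont: "continuous_on {0..} g" and bnd: "\<And>t. 0 \<le> t \<Longrightarrow> \<bar>g t\<bar> \<le> M"
    and zero: "\<And>\<sigma>. \<sigma> > 0 \<Longrightarrow> ((\<lambda>t. exp (- (\<sigma> * t)) * g t) has_integral 0) {0..}"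
    and "0 \<le> t0"
  shows "g t0 = 0"
proof -
  define \<phi> where "\<phi> t = exp (- t) * g t" for t
  have M: "0 \<le> M" using bnd[of 0] by simp
  have cont\<phi>: "continuous_on {0..} \<phi>"
    unfolding \<phi>_def by (intro continuous_intros cont)
  have \<phi>_bound: "\<bar>\<phi> t\<bar> \<le> M" if "0 \<le> t" for t
    unfolding \<phi>_def abs_mult using bnd[OF that] that mult_mono[of "exp (-t)" 1 "\<bar>g t\<bar>" M] by simp
  define \<psi> where "\<psi> u = (if u = 0 then 0 else u * g (- ln u))" for u
  have \<psi>_exp: "\<psi> (exp (- t)) = \<phi> t" for t by (simp add: \<psi>_def \<phi>_def)
  have cont\<psi>: "continuous_on {0..1} \<psi>"
    unfolding continuous_on
  proof
    fix u :: real assume u: "u \<in> {0..1}"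
    show "(\<psi> \<longlongrightarrow> \<psi> u) (at u within {0..1})"
    proof (cases "u = 0")
      case True
      have "(\<psi> \<longlongrightarrow> 0) (at 0 within {0..1})"
      proof (rule Lim_null_comparison)
        have "norm (\<psi> v) \<le> \<bar>v\<bar> * M" if "v \<in> {0..1}" for v
          using bnd[of "- ln v"] that by (auto simp: \<psi>_def abs_mult intro!: mult_left_mono)
        then show "\<forall>\<^sub>F v in at 0 within {0..1}. norm (\<psi> v) \<le> \<bar>v\<bar> * M"
          by (auto simp: eventually_at_filter)
        have "((\<lambda>v::real. \<bar>v\<bar> * M) \<longlongrightarrow> \<bar>0\<bar> * M) (at 0 within {0..1})"
          by (intro tendsto_intros)
        then show "((\<lambda>v::real. \<bar>v\<bar> * M) \<longlongrightarrow> 0) (at 0 within {0..1})" by simp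
      qed
      then show ?thesis using True by (simp add: \<psi>_def)
    next
      case False
      then have pos: "0 < u" using u by simp
      have "continuous_on {0<..1} (\<lambda>u. u * g (- ln u))"
        by (intro continuous_intros continuous_on_compose2[OF cont]) auto
      then have "continuous_on {0<..1} \<psi>"
        by (rule continuous_on_eq) (auto simp: \<psi>_def)
      then have "(\<psi> \<longlongrightarrow> \<psi> u) (at u within {0<..1})"
        using pos u unfolding continuous_on by auto
      moreover have "at u within {0<..1} = at u within {0..1}"
        by (rule at_within_nhd[of _ "{0<..}"]) (use pos in auto)
      ultimately show ?thesis by simp
    qed
  qed
  \<comment> \<open>The energy on each finite interval is bounded by an arbitrarily small total integral.\<close>
  have energy: "integral {0..T} (\<lambda>t. exp (- t) * (\<phi> t)\<^sup>2) \<le> 0" for T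
  proof (rule field_le_epsilon)
    fix e' :: real assume "e' > 0"
    \<comment> \<open>Dividing by \<open>M + 1\<close> rather than by \<open>M\<close> also covers \<open>M = 0\<close>.\<close>
    define e where "e = e' / (M + 1)"
    have e: "e > 0" "M * e \<le> e'" using M \<open>e' > 0\<close> by (auto simp: e_def field_simps)
    obtain P where P: "real_polynomial_function P" "\<And>u. u \<in> {0..1} \<Longrightarrow> \<bar>\<psi> u - P u\<bar> < e"
      using Stone_Weierstrass_real_polynomial_function[OF compact_Icc cont\<psi> e(1)] by blast
    then obtain a n where a: "P = (\<lambda>u. \<Sum>i\<le>n. a i * u ^ i)"
      unfolding real_polynomial_function_iff_sum by blast
    \<comment> \<open>The majorant \<open>R\<close> is integrable over the half line: its polynomial part contributes zero.\<close>
    define R where "R t = exp (- t) * \<phi> t * P (exp (- t)) + (M * e) * exp (- t)" for t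
    have "((\<lambda>t. (\<Sum>i\<le>n. a i * (exp (- (real (i + 2) * t)) * g t))) has_integral (\<Sum>i\<le>n. a i * 0)) {0..}"
      by (intro has_integral_sum has_integral_mult_right zero) auto
    moreover have "exp (- t) * \<phi> t * P (exp (- t)) = (\<Sum>i\<le>n. a i * (exp (- (real (i + 2) * t)) * g t))" for t
    proof -
      have "exp (- (real (i + 2) * t)) = exp (- t) * exp (- t) * exp (- t) ^ i" for i
        by (simp add: exp_of_nat_mult[symmetric] exp_add[symmetric] algebra_simps)
      then show ?thesis by (simp add: a \<phi>_def sum_distrib_left algebra_simps)
    qed
    ultimately have "((\<lambda>t. exp (- t) * \<phi> t * P (exp (- t))) has_integral 0) {0..}" by simp
    moreover have "((\<lambda>t. (M * e) * exp (- 1 * t)) has_integral (M * e) * (exp (- 1 * 0) / 1)) {0..}"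
      by (intro has_integral_mult_right has_integral_exp_minus_to_infinity) simp
    ultimately have R: "(R has_integral (0 + M * e)) {0..}"
      unfolding R_def by (intro has_integral_add) simp_all
    then have Rint: "\<And>T. R integrable_on {0..T}"
      and Rlim: "((\<lambda>T. integral {0..T} R) \<longlongrightarrow> M * e) at_top"
      unfolding has_integral_halfline_iff by simp_all
    have le: "exp (- t) * (\<phi> t)\<^sup>2 \<le> R t" if "0 \<le> t" for t
    proof -
      have "\<phi> t * (\<phi> t - P (exp (- t))) \<le> \<bar>\<phi> t\<bar> * \<bar>\<phi> t - P (exp (- t))\<bar>"
        by (metis abs_ge_self abs_mult)
      also have "\<dots> \<le> M * e"
        using \<phi>_bound[OF that] P(2)[of "exp (- t)"] that M by (intro mult_mono) (auto simp: \<psi>_exp)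
      finally have "exp (- t) * (\<phi> t * (\<phi> t - P (exp (- t)))) \<le> exp (- t) * (M * e)" by simp
      then show ?thesis by (simp add: R_def power2_eq_square algebra_simps)
    qed
    have int: "(\<lambda>t. exp (- t) * (\<phi> t)\<^sup>2) integrable_on {0..T}" for T
      by (intro integrable_continuous_interval continuous_intros continuous_on_subset[OF cont\<phi>]) auto
    have "integral {0..T} (\<lambda>t. exp (- t) * (\<phi> t)\<^sup>2) \<le> integral {0..T'} R" if "T \<le> T'" for T'
    proof -
      have "integral {0..T} (\<lambda>t. exp (- t) * (\<phi> t)\<^sup>2) \<le> integral {0..T'} (\<lambda>t. exp (- t) * (\<phi> t)\<^sup>2)"
        using that by (intro integral_subset_le int) auto
      also have "\<dots> \<le> integral {0..T'} R"
        by (intro integral_le int Rint le) auto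
      finally show ?thesis .
    qed
    then have "integral {0..T} (\<lambda>t. exp (- t) * (\<phi> t)\<^sup>2) \<le> M * e"
      by (intro tendsto_lowerbound[OF Rlim]) (auto simp: eventually_at_top_linorder)
    then show "integral {0..T} (\<lambda>t. exp (- t) * (\<phi> t)\<^sup>2) \<le> 0 + e'" using e by simp
  qed
  define T where "T = t0 + 1"
  have "integral {0..T} (\<lambda>t. exp (- t) * (\<phi> t)\<^sup>2) = 0"
    using energy by (intro antisym integral_nonneg integrable_continuous_interval continuous_intros
        continuous_on_subset[OF cont\<phi>]) auto
  moreover have "continuous_on {0..T} (\<lambda>t. exp (- t) * (\<phi> t)\<^sup>2)"
    by (intro continuous_intros continuous_on_subset[OF cont\<phi>]) auto
  ultimately have "\<forall>t\<in>{0..T}. exp (- t) * (\<phi> t)\<^sup>2 = 0"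
    using \<open>0 \<le> t0\<close> by (subst (asm) integral_eq_0_iff) (auto simp: T_def)
  then have "\<phi> t0 = 0" using \<open>0 \<le> t0\<close> by (auto simp: T_def)
  then show ?thesis by (simp add: \<phi>_def)
qed

lemma lerch_bounded:
  fixes g :: "real \<Rightarrow> complex"
  assumes "continuous_on {0..} g" "\<And>t. 0 \<le> t \<Longrightarrow> norm (g t) \<le> M"
    and "\<And>\<sigma>. \<sigma> > 0 \<Longrightarrow> has_laplace g \<sigma> 0" and "0 \<le> t"
  shows "g t = 0"
proof (rule complex_eqI)
  have "((\<lambda>t. exp (- (\<sigma> * t)) * Re (g t)) has_integral 0) {0..}"
    "((\<lambda>t. exp (- (\<sigma> * t)) * Im (g t)) has_integral 0) {0..}" if "\<sigma> > 0" for \<sigma>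
    using has_integral_linear[OF assms(3)[OF that, unfolded has_laplace_def] bounded_linear_Re]
      has_integral_linear[OF assms(3)[OF that, unfolded has_laplace_def] bounded_linear_Im]
    by (simp_all add: o_def)
  note int = this
  have "\<bar>Re (g t)\<bar> \<le> M" "\<bar>Im (g t)\<bar> \<le> M" if "0 \<le> t" for t
    using assms(2)[OF that] abs_Re_le_cmod[of "g t"] abs_Im_le_cmod[of "g t"] by linarith+
  note bnd = this
  show "Re (g t) = Re 0"
    using lerch_bounded_real[of "\<lambda>t. Re (g t)" M t] int(1) bnd(1) assms(1,4) by (simp add: continuous_on_Re)
  show "Im (g t) = Im 0"
    using lerch_bounded_real[of "\<lambda>t. Im (g t)" M t] int(2) bnd(2) assms(1,4) by (simp add: continuous_on_Im)
qed

lemma continuous_convergent_bounded: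
  fixes K :: "real \<Rightarrow> 'a::real_normed_vector"
  assumes cont: "continuous_on {0..} K" and lim: "(K \<longlongrightarrow> L) at_top"
  obtains M where "\<And>t. 0 \<le> t \<Longrightarrow> norm (K t) \<le> M"
proof -
  have "\<forall>\<^sub>F t in at_top. norm (K t) < norm L + 1"
    by (rule order_tendstoD(2)[OF tendsto_norm[OF lim]]) simp
  then obtain N where N: "\<And>t. N \<le> t \<Longrightarrow> norm (K t) < norm L + 1"
    unfolding eventually_at_top_linorder by blast
  have "bounded (K ` {0..N})"
    by (intro compact_imp_bounded compact_continuous_image continuous_on_subset[OF cont]) auto
  then obtain B where B: "\<And>t. t \<in> {0..N} \<Longrightarrow> norm (K t) \<le> B"
    unfolding bounded_iff by blast
  show ?thesis
  proof
    show "norm (K t) \<le> max B (norm L + 1)" if "0 \<le> t" for t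
      using B[of t] N[of t] that by (cases "t \<le> N") auto
  qed
qed

text \<open>A conditionally convergent transform says little about the size of \<open>f\<close>, which may even be unbounded
  near zero. The primitive \<open>K\<close> of \<open>exp (- s\<^sub>0 t) f t\<close> is continuous with a limit, hence bounded, and
  integration by parts turns the transform of \<open>f\<close> at \<open>s\<^sub>0 + \<sigma>\<close> into \<open>\<sigma>\<close> times that of
  \<open>K\<close> at \<open>\<sigma>\<close>.\<close>

lemma laplace_primitive:
  fixes f :: "real \<Rightarrow> complex"
  assumes cont: "continuous_on {0<..} f" and lap: "\<And>\<sigma>. 0 \<le> \<sigma> \<Longrightarrow> has_laplace f (s0 + \<sigma>) (F (s0 + \<sigma>))"
  obtains K M where "continuous_on {0..} K" "\<And>t. 0 \<le> t \<Longrightarrow> norm (K t) \<le> M"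
    and "\<And>t. 0 < t \<Longrightarrow> (K has_vector_derivative exp (- (s0 * t)) *\<^sub>R f t) (at t)"
    and "\<And>\<sigma>. 0 < \<sigma> \<Longrightarrow> has_laplace K \<sigma> (F (s0 + \<sigma>) / of_real \<sigma>)"
proof -
  define \<phi> where "\<phi> t = exp (- (s0 * t)) *\<^sub>R f t" for t
  define K where "K T = integral {0..T} \<phi>" for T
  have "(\<phi> has_integral F s0) {0..}"
    using lap[of 0] unfolding has_laplace_def \<phi>_def by simp
  then have int: "\<phi> integrable_on {0..T}" and limK: "(K \<longlongrightarrow> F s0) at_top" for T
    unfolding has_integral_halfline_iff K_def by auto
  have contK: "continuous_on {0..} K"
    unfolding continuous_on
  proof
    fix t :: real assume t: "t \<in> {0..}"
    have "continuous_on {0..t + 1} K"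
      unfolding K_def by (rule indefinite_integral_continuous_1[OF int])
    then have "(K \<longlongrightarrow> K t) (at t within {0..t + 1})"
      using t unfolding continuous_on by auto
    moreover have "at t within {0..t + 1} = at t within {0..}"
      by (rule at_within_nhd[of _ "{..<t + 1}"]) auto
    ultimately show "(K \<longlongrightarrow> K t) (at t within {0..})" by simp
  qed
  have cont\<phi>: "continuous_on {0<..} \<phi>"
    unfolding \<phi>_def by (intro continuous_intros cont)
  have derK: "(K has_vector_derivative \<phi> t) (at t)" if "0 < t" for t
  proof -
    have "continuous (at t) \<phi>"
      using cont\<phi> that by (simp add: continuous_on_eq_continuous_at)
    then have "continuous (at t within {0..t + 1}) \<phi>"
      by (rule continuous_at_imp_continuous_within)
    then have "(K has_vector_derivative \<phi> t) (at t within {0..t + 1})"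
      unfolding K_def using that integral_has_vector_derivative_continuous_at[OF int[of "t + 1"], of t "{}"]
      by simp
    moreover have "at t within {0..t + 1} = at t"
      using that by (intro at_within_interior) simp
    ultimately show ?thesis by simp
  qed
  obtain M where M: "\<And>t. 0 \<le> t \<Longrightarrow> norm (K t) \<le> M"
    using continuous_convergent_bounded[OF contK limK] by blast
  have lapK: "has_laplace K \<sigma> (F (s0 + \<sigma>) / of_real \<sigma>)" if \<sigma>: "0 < \<sigma>" for \<sigma>
  proof -
    let ?E = "\<lambda>t. exp (- (\<sigma> * t)) *\<^sub>R K t"
    have contE: "continuous_on {0..} ?E" by (intro continuous_intros contK)
    have limE: "(?E \<longlongrightarrow> 0) at_top"
    proof (rule Lim_null_comparison)
      show "\<forall>\<^sub>F t in at_top. norm (?E t) \<le> M * exp (- (\<sigma> * t))"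
        using eventually_ge_at_top[of 0] by eventually_elim (use M in \<open>auto simp: mult.commute\<close>)
      have "filterlim (\<lambda>t. - (\<sigma> * t)) at_bot at_top"
        unfolding filterlim_uminus_at_top[symmetric]
        by (rule filterlim_tendsto_pos_mult_at_top[OF tendsto_const \<sigma> filterlim_ident])
      then show "((\<lambda>t. M * exp (- (\<sigma> * t))) \<longlongrightarrow> 0) at_top"
        using tendsto_mult_right_zero[OF filterlim_compose[OF exp_at_bot]] by blast
    qed
    have "(?E has_vector_derivative (exp (- (\<sigma> * t)) *\<^sub>R \<phi> t - \<sigma> *\<^sub>R ?E t)) (at t)" if "0 < t" for t
      by (rule derivative_eq_intros derK that refl | simp add: algebra_simps)+
    from has_integral_halfline_ftc[OF contE this limE]
    have "((\<lambda>t. exp (- (\<sigma> * t)) *\<^sub>R \<phi> t - \<sigma> *\<^sub>R ?E t) has_integral 0) {0..}"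
      by (simp add: K_def)
    moreover have "((\<lambda>t. exp (- (\<sigma> * t)) *\<^sub>R \<phi> t) has_integral F (s0 + \<sigma>)) {0..}"
    proof -
      have "exp (- (\<sigma> * t)) *\<^sub>R \<phi> t = exp (- ((s0 + \<sigma>) * t)) *\<^sub>R f t" for t
        by (simp add: \<phi>_def exp_add[symmetric] algebra_simps)
      then show ?thesis using lap[of \<sigma>] \<sigma> by (simp add: has_laplace_def)
    qed
    ultimately have "((\<lambda>t. exp (- (\<sigma> * t)) *\<^sub>R \<phi> t - (exp (- (\<sigma> * t)) *\<^sub>R \<phi> t - \<sigma> *\<^sub>R ?E t))
        has_integral (F (s0 + \<sigma>) - 0)) {0..}"
      by (intro has_integral_diff)
    then have "((\<lambda>t. inverse \<sigma> *\<^sub>R (\<sigma> *\<^sub>R ?E t)) has_integral (inverse \<sigma> *\<^sub>R F (s0 + \<sigma>))) {0..}"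
      by (intro has_integral_cmul) simp
    moreover have "inverse \<sigma> *\<^sub>R (\<sigma> *\<^sub>R ?E t) = ?E t" for t using \<sigma> by simp
    moreover have "inverse \<sigma> *\<^sub>R F (s0 + \<sigma>) = F (s0 + \<sigma>) / of_real \<sigma>"
      by (simp add: scaleR_conv_of_real divide_inverse mult.commute)
    ultimately show ?thesis by (simp only: has_laplace_def)
  qed
  show thesis
    using that[OF contK M _ lapK] derK unfolding \<phi>_def by blast
qed

text \<open>The bounded primitive \<open>K\<close> has transform \<open>d / \<sigma>\<close>, the same as the constant \<open>d\<close>, so
  \<open>K\<close> is constant and its derivative vanishes. Allowing a constant \<open>d\<close> instead of zero saves an
  argument about the limit of the transform at infinity.\<close>

lemma lerch_constant:
  fixes f :: "real \<Rightarrow> complex"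
  assumes cont: "continuous_on {0<..} f" and lap: "\<And>s. c < s \<Longrightarrow> has_laplace f s d" and t: "0 < t"
  shows "f t = 0"
proof -
  have "has_laplace f ((c + 1) + \<sigma>) d" if "0 \<le> \<sigma>" for \<sigma> using lap that by simp
  from laplace_primitive[OF cont this]
  obtain K M where K: "continuous_on {0..} K" "\<And>t. 0 \<le> t \<Longrightarrow> norm (K t) \<le> M"
    and derK: "\<And>t. 0 < t \<Longrightarrow> (K has_vector_derivative exp (- ((c + 1) * t)) *\<^sub>R f t) (at t)"
    and lapK: "\<And>\<sigma>. 0 < \<sigma> \<Longrightarrow> has_laplace K \<sigma> (d / of_real \<sigma>)"
    by (metis (no_types, lifting))
  have "K t - d = 0" if "0 \<le> t" for t
  proof (rule lerch_bounded[OF _ _ _ that])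
    show "continuous_on {0..} (\<lambda>t. K t - d)" by (intro continuous_intros K)
    show "norm (K t - d) \<le> M + norm d" if "0 \<le> t" for t
      using K(2)[OF that] norm_triangle_ineq4[of "K t" d] by linarith
    show "has_laplace (\<lambda>t. K t - d) \<sigma> 0" if "0 < \<sigma>" for \<sigma>
    proof -
      have "has_laplace (\<lambda>t. d) \<sigma> (d / of_real \<sigma>)"
        using has_laplace_exp_monomial[of 0 \<sigma> d 0] that by simp
      from has_laplace_diff[OF lapK[OF that] this] show ?thesis by simp
    qed
  qed
  then have "\<And>t. t \<in> {0<..} \<Longrightarrow> d = K t" by simp
  then have "(K has_vector_derivative 0) (at t)"
    using t by (intro has_vector_derivative_transform_within_open[of "\<lambda>t. d" 0 t "{0<..}" K]) auto
  with derK[OF t] have "exp (- ((c + 1) * t)) *\<^sub>R f t = 0"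
    by (rule vector_derivative_unique_at)
  then show ?thesis by simp
qed

text \<open>This excludes a nonconstant polynomial part in a rational transform.\<close>

lemma laplace_bounded:
  fixes f :: "real \<Rightarrow> complex"
  assumes "continuous_on {0<..} f" "\<And>s. c < s \<Longrightarrow> has_laplace f s (F s)"
  obtains s0 M where "\<And>s. s0 < s \<Longrightarrow> norm (F s) \<le> M"
proof -
  have "has_laplace f ((c + 1) + \<sigma>) (F ((c + 1) + \<sigma>))" if "0 \<le> \<sigma>" for \<sigma> using assms that by simp
  from laplace_primitive[where F = F, OF assms(1) this]
  obtain K M where K: "continuous_on {0..} K" "\<And>t. 0 \<le> t \<Longrightarrow> norm (K t) \<le> M"
    and lapK: "\<And>\<sigma>. 0 < \<sigma> \<Longrightarrow> has_laplace K \<sigma> (F ((c + 1) + \<sigma>) / of_real \<sigma>)"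
    by (metis (no_types, lifting))
  have "norm (F s) \<le> M" if "c + 1 < s" for s
  proof -
    define \<sigma> where "\<sigma> = s - (c + 1)"
    have \<sigma>: "0 < \<sigma>" using that by (simp add: \<sigma>_def)
    have "((\<lambda>t. exp (- (\<sigma> * t)) *\<^sub>R K t) has_integral (F s / of_real \<sigma>)) {0..}"
      using lapK[OF \<sigma>] by (simp add: has_laplace_def \<sigma>_def)
    note F = has_integral_integrable[OF this] integral_unique[OF this]
    have "((\<lambda>t. M * exp (- \<sigma> * t)) has_integral M * (exp (- \<sigma> * 0) / \<sigma>)) {0..}"
      by (intro has_integral_mult_right has_integral_exp_minus_to_infinity \<sigma>)
    note E = has_integral_integrable[OF this] integral_unique[OF this]
    have "norm (F s / of_real \<sigma>) \<le> M * (exp (- \<sigma> * 0) / \<sigma>)"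
      using integral_norm_bound_integral[OF F(1) E(1)] K(2) unfolding F(2) E(2) by (simp add: mult.commute)
    then show ?thesis using \<sigma> by (simp add: norm_divide divide_le_cancel)
  qed
  then show thesis by (rule that)
qed

section \<open>Functions with a rational transform\<close>

text \<open>Divide with remainder. The remainder over \<open>q\<close> is the transform of an exponential polynomial
  \<open>h\<close>, so \<open>f - h\<close> has a polynomial as its transform. That polynomial is bounded, hence constant,
  and uniqueness applies.\<close>

lemma rational_laplace_imp_exp_poly:
  fixes f :: "real \<Rightarrow> complex" and p q :: "complex poly"
  assumes cont: "continuous_on {0<..} f"
    and lap: "\<And>s. c < s \<Longrightarrow> has_laplace f s (poly p (of_real s) / poly q (of_real s))"
    and q: "q \<noteq> 0"
  shows "\<exists>h\<in>exp_poly {l. poly q l = 0}. \<forall>t>0. f t = h t"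
proof -
  define d where "d = p div q"
  have "degree (p mod q) < degree q \<or> p mod q = 0" using degree_mod_less[OF q] by blast
  from strictly_proper_inverse_laplace[OF q this]
  obtain h where h: "h \<in> exp_poly {l. poly q l = 0}"
    and hlap: "\<And>s. (\<forall>l. poly q l = 0 \<longrightarrow> Re l < s) \<Longrightarrow>
        has_laplace h s (poly (p mod q) (of_real s) / poly q (of_real s))"
    by metis
  obtain c' where c': "\<And>l. poly q l = 0 \<Longrightarrow> Re l \<le> c'" "c \<le> c'"
  proof
    define R where "R = insert c (Re ` {l. poly q l = 0})"
    have fin: "finite R" unfolding R_def using poly_roots_finite[OF q] by simp
    show "Re l \<le> Max R" if "poly q l = 0" for l
      using fin that by (intro Max_ge) (auto simp: R_def)
    show "c \<le> Max R" using fin by (intro Max_ge) (auto simp: R_def)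
  qed
  have lapd: "has_laplace (\<lambda>t. f t - h t) s (poly d (of_real s))" if s: "c' < s" for s
  proof -
    have root: "\<forall>l. poly q l = 0 \<longrightarrow> Re l < s" using c'(1) s by fastforce
    then have qs: "poly q (of_real s) \<noteq> 0" by force
    have "p = d * q + p mod q" unfolding d_def by simp
    then have "poly p (of_real s) = poly d (of_real s) * poly q (of_real s) + poly (p mod q) (of_real s)"
      by (metis poly_add poly_mult)
    then have "poly p (of_real s) / poly q (of_real s) - poly (p mod q) (of_real s) / poly q (of_real s)
        = poly d (of_real s)"
      using qs by (simp add: field_simps)
    with has_laplace_diff[OF lap hlap[OF root]] s c'(2) show ?thesis by auto
  qed
  have conth: "continuous_on {0<..} h"
  proof -
    obtain h' where "\<And>t. (h has_vector_derivative h' t) (at t)" using exp_poly_derivative[OF h] by blast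
    then have "isCont h t" for t by (rule has_vector_derivative_continuous)
    then show ?thesis by (simp add: continuous_at_imp_continuous_on)
  qed
  have contfh: "continuous_on {0<..} (\<lambda>t. f t - h t)" by (intro continuous_intros cont conth)
  obtain s0 M where M: "\<And>s. s0 < s \<Longrightarrow> norm (poly d (of_real s)) \<le> M"
    using laplace_bounded[where F = "\<lambda>s. poly d (of_real s)", OF contfh lapd] by blast
  obtain a d' where d: "d = pCons a d'" by (cases d)
  have "d' = 0"
  proof (rule ccontr)
    assume "d' \<noteq> 0"
    then obtain r where r: "\<And>z. r \<le> norm z \<Longrightarrow> M + 1 \<le> norm (poly d z)"
      using poly_infinity[of d' "M + 1" a] unfolding d by blast
    define s where "s = max \<bar>r\<bar> \<bar>s0\<bar> + 1"
    have "r \<le> norm (complex_of_real s)" "s0 < s" by (auto simp: s_def)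
    then show False using r[of "of_real s"] M[of s] by linarith
  qed
  then have "has_laplace (\<lambda>t. f t - h t) s a" if "c' < s" for s
    using lapd[OF that] by (simp add: d)
  from lerch_constant[OF contfh this] have "f t = h t" if "0 < t" for t using that by simp
  then show ?thesis using h by blast
qed

text \<open>The exponents are zeros of the denominator of \<open>F\<close>, and these lie outside \<open>Z\<close>.\<close>

lemma rat_on_laplace_imp_exp_poly:
  fixes f :: "real \<Rightarrow> complex"
  assumes cont: "continuous_on {0<..} f"
    and lap: "\<And>s. c < s \<Longrightarrow> has_laplace f s (F (of_real s))"
    and F: "rat_on Z F" and Z: "\<And>s. c < s \<Longrightarrow> of_real s \<in> Z"
  shows "\<exists>h\<in>exp_poly (- Z). \<forall>t>0. f t = h t"
proof -
  obtain p q where pq: "\<And>s. s \<in> Z \<Longrightarrow> poly q s \<noteq> 0 \<and> F s = poly p s / poly q s"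
    using F unfolding rat_on_def by blast
  have "q \<noteq> 0" using pq[OF Z[of "c + 1"]] by auto
  have "has_laplace f s (poly p (of_real s) / poly q (of_real s))" if "c < s" for s
    using lap[OF that] pq[OF Z[OF that]] by simp
  from rational_laplace_imp_exp_poly[OF cont this \<open>q \<noteq> 0\<close>]
  obtain h where h: "h \<in> exp_poly {l. poly q l = 0}" "\<forall>t>0. f t = h t" by blast
  have "h \<in> exp_poly (- Z)"
    by (rule exp_poly_mono[OF h(1)]) (use pq in blast)
  then show ?thesis using h(2) by blast
qed

section \<open>Consensus\<close>

theorem theorem7:
  fixes n :: nat
    and E :: "nat \<Rightarrow> ('N::finite \<times> 'N) set"
    and W L :: "nat \<Rightarrow> real^'N^'N"
    and \<Delta> :: "nat \<Rightarrow> complex \<Rightarrow> complex^'N^'N"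
    and U_ref X :: "complex \<Rightarrow> complex^'N"
    and x :: "real \<Rightarrow> real^'N"
    and c :: real
  assumes "1 \<le> n"
    and "\<And>k. k \<in> {1..n} \<Longrightarrow> adjacency_matrix (E k) (W k)"
    and "\<And>k. k \<in> {1..n} \<Longrightarrow> connected_spanning_tree (E k)"
    and "\<And>k. k \<in> {1..n} \<Longrightarrow> L k = graph_laplacian (W k)"
    and "\<And>k. k \<in> {1..n} \<Longrightarrow> L k = transpose (L k)"
    and "U_ref \<in> RHinf_vec"
    and "\<And>k. k \<in> {0..n} \<Longrightarrow> \<Delta> k \<in> RHinf_mat"
    and "continuous_on {0<..} x"
    and "laplace_transform_right_of c x X"
    and "\<And>s. c < Re s \<Longrightarrow> perturbed_serial_consensus n L \<Delta> s *v X s = U_ref s"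
    and "\<And>k. k \<in> {0..n} \<Longrightarrow> hinf_norm (\<Delta> k) < 1"
    and "hinf_norm (\<Delta> 0) + hinf_norm (\<Delta> n) < 1"
  shows "achieves_consensus n x"
proof -
  define r :: 'N where "r = undefined"
  \<comment> \<open>Right of \<open>c0\<close> the transform exists and \<open>s\<close> is nonzero, so that dividing by \<open>s\<close> is allowed.\<close>
  define c0 where "c0 = max c 0"
  define D where "D = {s. c0 < Re s}"
  have D: "D \<subseteq> closed_rhp" "0 \<notin> D" by (auto simp: D_def c0_def)
  have lapl: "L k = graph_laplacian (W k)" "graph_laplacian (W k) = transpose (graph_laplacian (W k))"
    if "k \<in> {1..n}" for k
  proof -
    show "L k = graph_laplacian (W k)" by (rule assms(4)[OF that])
    show "graph_laplacian (W k) = transpose (graph_laplacian (W k))"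
      using assms(5)[OF that] unfolding assms(4)[OF that] .
  qed
  let ?A = "\<lambda>s k. mat s + (mat 1 + \<Delta> k s) ** map_matrix complex_of_real (L k)"
  have n: "n \<in> {1..n}" "n \<in> {0..n}" "0 \<in> {0..n}" using assms(1) by auto
  have "disagreement_rat_on r closed_rhp D (\<lambda>s. ordered_prod (?A s) [1..<n] *v X s)"
  proof (rule disagreement_through_leading_factor[OF assms(2)[OF n(1)] assms(3)[OF n(1)] lapl(2)[OF n(1)]
        assms(7)[OF n(3)] assms(7)[OF n(2)] assms(12) D assms(6)])
    show "(mat s + mat s ** \<Delta> 0 s + (mat 1 + \<Delta> n s) ** map_matrix complex_of_real (graph_laplacian (W n)))
        *v (ordered_prod (?A s) [1..<n] *v X s) = U_ref s" if "s \<in> D" for s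
    proof -
      have "c < Re s" using that by (simp add: D_def c0_def)
      from assms(10)[OF this] show ?thesis
        unfolding perturbed_serial_consensus_def lapl(1)[OF n(1)] matrix_vector_mul_assoc .
    qed
  qed
  then have X: "disagreement_rat_on r closed_rhp D X"
  proof (rule disagreement_through_product[rotated])
    fix k y assume k: "k \<in> set [1..<n]" and y: "disagreement_rat_on r closed_rhp D (\<lambda>s. ?A s k *v y s)"
    then have k': "k \<in> {1..n}" "k \<in> {0..n}" by auto
    have "disagreement_rat_on r closed_rhp D
        (\<lambda>s. (mat s + (mat 1 + \<Delta> k s) ** map_matrix complex_of_real (graph_laplacian (W k))) *v y s)"
      using y unfolding lapl(1)[OF k'(1)] .
    then show "disagreement_rat_on r closed_rhp D y"
      by (rule disagreement_through_factor[OF assms(2)[OF k'(1)] assms(3)[OF k'(1)] lapl(2)[OF k'(1)]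
          assms(7)[OF k'(2)] assms(11)[OF k'(2)] D])
  qed
  then obtain u where u: "\<And>i. rat_on closed_rhp (\<lambda>s. u s $ i)"
    and Xu: "\<And>s i. s \<in> D \<Longrightarrow> X s $ i = X s $ r + u s $ i" and Xr: "rat_on D (\<lambda>s. X s $ r)"
    unfolding disagreement_rat_on_def by blast
  define f where "f i t = complex_of_real (x t $ i)" for i t
  have lap: "has_laplace (f i) s (X (of_real s) $ i)" if "c0 < s" for i s
  proof -
    have eq: "exp (- complex_of_real s * of_real t) = of_real (exp (- (s * t)))" for t
      by (simp add: exp_of_real[symmetric])
    have "c < Re (of_real s)" using that by (simp add: c0_def)
    then have "((\<lambda>t. exp (- complex_of_real s * of_real t) * of_real (x t $ i)) has_integral X (of_real s) $ i) {0..}"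
      using assms(9) unfolding laplace_transform_right_of_def by blast
    then show ?thesis unfolding eq has_laplace_def f_def scaleR_conv_of_real .
  qed
  have cont: "continuous_on {0<..} (f i)" for i
    unfolding f_def by (intro continuous_intros assms(8))
  have inD: "complex_of_real s \<in> D" "complex_of_real s \<in> closed_rhp" if "c0 < s" for s
    using that by (auto simp: D_def c0_def)
  have XD: "rat_on D (\<lambda>s. X s $ i)" for i
  proof -
    have "rat_on D (\<lambda>s. X s $ r + u s $ i)"
      by (intro rat_on_add Xr rat_on_subset[OF u D(1)])
    then show ?thesis by (rule rat_on_cong[THEN iffD1, rotated]) (rule Xu[symmetric])
  qed
  have ex: "\<exists>h\<in>exp_poly (- D). \<forall>t>0. f i t = h t" for i
    by (rule rat_on_laplace_imp_exp_poly[OF cont lap XD inD(1)])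
  have x: "\<exists>h\<in>exp_poly (- D). \<forall>t>0. x t $ i = Re (h t)" for i
    using ex[of i] unfolding f_def by (metis Re_complex_of_real)
  have diff: "(deriv ^^ k) (\<lambda>t. x t $ i) differentiable (at t)" if "0 < t" for i k t
  proof -
    obtain h where "h \<in> exp_poly (- D)" "\<And>t. 0 < t \<Longrightarrow> x t $ i = Re (h t)" using x[of i] by blast
    then show ?thesis using that by (rule iterated_deriv_exp_poly(2))
  qed
  have lim: "((\<lambda>t. \<bar>(deriv ^^ k) (\<lambda>t. x t $ i) t - (deriv ^^ k) (\<lambda>t. x t $ j) t\<bar>) \<longlongrightarrow> 0) at_top" for i j k
  proof -
    \<comment> \<open>The common component cancels, which leaves a transform without poles in the closed right half plane.\<close>
    have lapdiff: "has_laplace (\<lambda>t. f i t - f j t) s (u (of_real s) $ i - u (of_real s) $ j)" if "c0 < s" for s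
      using has_laplace_diff[OF lap[OF that, of i] lap[OF that, of j]] Xu[OF inD(1)[OF that], of i]
        Xu[OF inD(1)[OF that], of j] by simp
    have "rat_on closed_rhp (\<lambda>s. u s $ i - u s $ j)" by (intro rat_on_diff u)
    from rat_on_laplace_imp_exp_poly[OF continuous_on_diff[OF cont cont] lapdiff this inD(2)]
    obtain h where h: "h \<in> exp_poly (- closed_rhp)" and "\<And>t. 0 < t \<Longrightarrow> f i t - f j t = h t" by blast
    then have "x t $ i - x t $ j = Re (h t)" if "0 < t" for t
      using that unfolding f_def by (metis Re_complex_of_real minus_complex.sel(1))
    from iterated_deriv_exp_poly(1)[OF h this]
    obtain h' where h': "h' \<in> exp_poly (- closed_rhp)"
      and eq: "\<And>t. 0 < t \<Longrightarrow> (deriv ^^ k) (\<lambda>t. x t $ i - x t $ j) t = Re (h' t)" by blast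
    have "(h' \<longlongrightarrow> 0) at_top" by (rule exp_poly_tendsto_0[OF h']) auto
    then have "((\<lambda>t. \<bar>Re (h' t)\<bar>) \<longlongrightarrow> \<bar>Re 0\<bar>) at_top" by (intro tendsto_intros)
    then have "((\<lambda>t. \<bar>Re (h' t)\<bar>) \<longlongrightarrow> 0) at_top" by simp
    moreover have "\<forall>\<^sub>F t in at_top. \<bar>Re (h' t)\<bar> = \<bar>(deriv ^^ k) (\<lambda>t. x t $ i) t - (deriv ^^ k) (\<lambda>t. x t $ j) t\<bar>"
      using eventually_gt_at_top[of 0]
    proof eventually_elim
      case (elim t)
      have "(deriv ^^ k) (\<lambda>t. x t $ i - x t $ j) t = (deriv ^^ k) (\<lambda>t. x t $ i) t - (deriv ^^ k) (\<lambda>t. x t $ j) t"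
        by (rule iterated_deriv_diff[OF diff diff elim])
      then show ?case by (simp only: eq[OF elim, symmetric])
    qed
    ultimately show ?thesis by (rule Lim_transform_eventually)
  qed
  show ?thesis unfolding achieves_consensus_def using diff lim by blast
qed

end
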